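(* Solutions of all linear second order ordinary differential equations $u''(x)+h(x)u(x)=0$, with any real-valued $h$ of class $C^1$, can be locally expressed through geodesic curves in two-dimensional anti-de Sitter geometry. More precisely: Let $h:\mathbb{R}\to\mathbb{R}$ be of class $C^1$, let $x_0\in\mathbb{R}$, and let $\Psi$ be a positive real-valued function of class $C^2$ on some interval $]x_-,x_+[$ with $x_-<x_0<x_+$, such that $h(x)\neq-\Psi^2(x)$ on this interval. Suppose that $h+\Psi^2\not\equiv\Psi'$ and $h+\Psi^2\not\equiv-\Psi'$ on $]x_-,x_+[$, and put $$\widetilde u_{\mathtt{top}}(x)=\exp\left[-\int_{x_0}^{x}d\xi\,\Psi(\xi)\,\frac{\Psi'(\xi)+i\sqrt{[h(\xi)+\Psi^{2}(\xi)]^{2}-[\Psi'(\xi)]^{2}}}{h(\xi)+\Psi^{2}(\xi)}\right],$$ $$\widetilde u_{\mathtt{bot}}(x)=\exp\left[-\int_{x_0}^{x}d\xi\,\Psi(\xi)\,\frac{\Psi'(\xi)-i\sqrt{[h(\xi)+\Psi^{2}(\xi)]^{2}-[\Psi'(\xi)]^{2}}}{h(\xi)+\Psi^{2}(\xi)}\right].$$ Then, for two arbitrary constants $A$ and $B$, $$u(x)=A\,\widetilde u_{\mathtt{top}}(x)+B\,\widetilde u_{\mathtt{bot}}(x)$$ is a general solution of $u''(x)+h(x)u(x)=0$ on $]x_-,x_+[$ if and only if $\Psi$ is a solution on this interval of $$\Psi''(x)=\frac{3\Psi^{2}(x)-h(x)}{\Psi^{2}(x)+h(x)}\,\frac{[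\Psi'(x)]^{2}}{\Psi(x)}+\frac{h'(x)\Psi'(x)}{\Psi^{2}(x)+h(x)}-\frac{\Psi^{4}(x)-h^{2}(x)}{\Psi(x)}.$$
   Context: The displayed second order equation for $\Psi$ is the equation of geodesic curves in explicit form on the Lorentzian manifold $\widetilde{\mathbb M}_h^+=(\widetilde{\mathcal H}_0,\widetilde g_h)$, where $\widetilde{\mathcal H}_0=\{(x,\varPsi)\in\mathbb{R}\times\mathbb{R}_{>0}:\varPsi^2\neq-h(x)\}$ and $\widetilde g_h=\varPsi^{-2}\left[-(h(x)+\varPsi^2)^2dx^2+d\varPsi^2\right]$, which is locally two-dimensional anti-de Sitter space. Here "explicit form" means: for a geodesic $s\mapsto(x(s),\varPsi(s))$ with $\dot x(s)\neq0$ on an interval around $s=0$, one writes $\varPsi(s)=\Psi(x(s))$. Solutions are allowed to be complex-valued; "general solution" means that, as $A,B$ range over all constants, $u$ ranges over all solutions. The square root of a real number is the principal one (for a negative argument it is purely imaginary). *)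

theory Defs
  imports "HOL-Analysis.Analysis"
begin

section \<open>Geodesics and anti-de Sitter space\<close>

text \<open>A pseudo-Riemannian metric on an open subset of \<open>real ^ 'n\<close> is given by its matrix of
  components in the standard coordinates.\<close>

definition partial_deriv :: "'n::finite \<Rightarrow> (real ^ 'n \<Rightarrow> real) \<Rightarrow> real ^ 'n \<Rightarrow> real" where
  "partial_deriv i f p = deriv (\<lambda>t. f (p + t *\<^sub>R axis i 1)) 0"

definition christoffel ::
    "(real ^ 'n \<Rightarrow> real ^ 'n ^ 'n) \<Rightarrow> 'n::finite \<Rightarrow> 'n \<Rightarrow> 'n \<Rightarrow> real ^ 'n \<Rightarrow> real" where
  "christoffel g k i j p =
     (\<Sum>l\<in>UNIV. matrix_inv (g p) $ k $ l *
        (partial_deriv i (\<lambda>q. g q $ l $ j) p + partial_deriv j (\<lambda>q. g q $ l $ i) p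
           - partial_deriv l (\<lambda>q. g q $ i $ j) p)) / 2"

text \<open>Geodesics are affinely parametrised, as usual; no causal type is prescribed.\<close>

definition geodesic_on ::
    "(real ^ 'n::finite) set \<Rightarrow> (real ^ 'n \<Rightarrow> real ^ 'n ^ 'n) \<Rightarrow> real set \<Rightarrow> (real \<Rightarrow> real ^ 'n) \<Rightarrow> bool"
  where
  "geodesic_on M g J \<gamma> \<longleftrightarrow>
     (\<forall>s\<in>J. \<gamma> s \<in> M) \<and>
     (\<exists>\<gamma>' \<gamma>''. \<forall>s\<in>J.
        (\<gamma> has_vector_derivative \<gamma>' s) (at s) \<and>
        (\<gamma>' has_vector_derivative \<gamma>'' s) (at s) \<and>
        (\<forall>k. \<gamma>'' s $ k
           + (\<Sum>i\<in>UNIV. \<Sum>j\<in>UNIV. christoffel g k i j (\<gamma> s) * \<gamma>' s $ i * \<gamma>' s $ j) = 0))"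

text \<open>Two-dimensional anti-de Sitter space of radius 1 as a quadric in three-dimensional space with
  a form of signature \<open>(-,-,+)\<close>; its metric is the restriction of this form.\<close>

definition ads_form :: "real ^ 3 \<Rightarrow> real ^ 3 \<Rightarrow> real" where
  "ads_form v w = - (v $ 1 * w $ 1) - v $ 2 * w $ 2 + v $ 3 * w $ 3"

definition AdS2 :: "(real ^ 3) set" where
  "AdS2 = {X. ads_form X X = -1}"

text \<open>Every point has an open neighbourhood that is isometric, by a map of class \<open>C\<^sup>1\<close>, to an
  open subset of the quadric.\<close>

definition locally_AdS2 :: "(real ^ 2) set \<Rightarrow> (real ^ 2 \<Rightarrow> real ^ 2 ^ 2) \<Rightarrow> bool" where
  "locally_AdS2 M g \<longleftrightarrow>
     (\<forall>p\<in>M. \<exists>U \<phi>. \<exists>\<phi>' :: real ^ 2 \<Rightarrow> ((real ^ 2) \<Rightarrow>\<^sub>L (real ^ 3)).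
        open U \<and> p \<in> U \<and> U \<subseteq> M \<and>
        inj_on \<phi> U \<and> openin (top_of_set AdS2) (\<phi> ` U) \<and>
        continuous_on U \<phi>' \<and>
        (\<forall>q\<in>U. (\<phi> has_derivative blinfun_apply (\<phi>' q)) (at q) \<and>
           (\<forall>v w. ads_form (blinfun_apply (\<phi>' q) v) (blinfun_apply (\<phi>' q) w)
                    = v \<bullet> (g q *v w))))"


section \<open>The Lorentzian manifold attached to a coefficient function\<close>

text \<open>Points are \<open>(x, \<Psi>)\<close>: component 1 is \<open>x\<close> and component 2 is \<open>\<Psi>\<close>.\<close>

definition H0 :: "(real \<Rightarrow> real) \<Rightarrow> (real ^ 2) set" where
  "H0 h = {p. p $ 2 > 0 \<and> (p $ 2)\<^sup>2 \<noteq> - h (p $ 1)}"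

definition metric_h :: "(real \<Rightarrow> real) \<Rightarrow> real ^ 2 \<Rightarrow> real ^ 2 ^ 2" where
  "metric_h h p =
     vector [vector [- ((h (p $ 1) + (p $ 2)\<^sup>2)\<^sup>2) / (p $ 2)\<^sup>2, 0],
             vector [0, 1 / (p $ 2)\<^sup>2]]"

text \<open>The graph of \<open>\<Psi>\<close> over \<open>I\<close> is a geodesic that passes through abscissa \<open>x0\<close> at parameter 0.\<close>

definition explicit_geodesic ::
    "(real \<Rightarrow> real) \<Rightarrow> real \<Rightarrow> real set \<Rightarrow> (real \<Rightarrow> real) \<Rightarrow> bool" where
  "explicit_geodesic h x0 I \<Psi> \<longleftrightarrow>
     (\<exists>J \<gamma>. open J \<and> is_interval J \<and> 0 \<in> J \<and>
        geodesic_on (H0 h) (metric_h h) J \<gamma> \<and>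
        \<gamma> 0 $ 1 = x0 \<and>
        (\<forall>s\<in>J. vector_derivative \<gamma> (at s) $ 1 \<noteq> 0) \<and>
        (\<lambda>s. \<gamma> s $ 1) ` J = I \<and>
        (\<forall>s\<in>J. \<gamma> s $ 2 = \<Psi> (\<gamma> s $ 1)))"

definition explicit_geodesic_equation ::
    "(real \<Rightarrow> real) \<Rightarrow> real set \<Rightarrow> (real \<Rightarrow> real) \<Rightarrow> bool" where
  "explicit_geodesic_equation h I \<Psi> \<longleftrightarrow>
     (\<forall>x\<in>I. deriv (deriv \<Psi>) x =
        (3 * (\<Psi> x)\<^sup>2 - h x) / ((\<Psi> x)\<^sup>2 + h x) * ((deriv \<Psi> x)\<^sup>2 / \<Psi> x)
        + deriv h x * deriv \<Psi> x / ((\<Psi> x)\<^sup>2 + h x)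
        - ((\<Psi> x) ^ 4 - (h x)\<^sup>2) / \<Psi> x)"


section \<open>The linear equation and its candidate solutions\<close>

definition is_solution :: "(real \<Rightarrow> real) \<Rightarrow> real set \<Rightarrow> (real \<Rightarrow> complex) \<Rightarrow> bool" where
  "is_solution h I u \<longleftrightarrow>
     (\<exists>u' u''. \<forall>x\<in>I.
        (u has_vector_derivative u' x) (at x) \<and>
        (u' has_vector_derivative u'' x) (at x) \<and>
        u'' x + complex_of_real (h x) * u x = 0)"

text \<open>\<open>A v + B w\<close> is a general solution: as \<open>A\<close> and \<open>B\<close> range over all complex constants,
  it ranges over exactly the solutions (as functions on \<open>I\<close>).\<close>

definition general_solution ::
    "(real \<Rightarrow> real) \<Rightarrow> real set \<Rightarrow> (real \<Rightarrow> complex) \<Rightarrow> (real \<Rightarrow> complex) \<Rightarrow> bool" where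
  "general_solution h I v w \<longleftrightarrow>
     (\<forall>u. is_solution h I u \<longleftrightarrow> (\<exists>A B. \<forall>x\<in>I. u x = A * v x + B * w x))"

definition C2_differentiable_on :: "(real \<Rightarrow> real) \<Rightarrow> real set \<Rightarrow> bool" where
  "C2_differentiable_on f I \<longleftrightarrow> f C1_differentiable_on I \<and> deriv f C1_differentiable_on I"

definition admissible :: "(real \<Rightarrow> real) \<Rightarrow> real set \<Rightarrow> (real \<Rightarrow> real) \<Rightarrow> bool" where
  "admissible h I \<Psi> \<longleftrightarrow>
     C2_differentiable_on \<Psi> I \<and>
     (\<forall>x\<in>I. \<Psi> x > 0) \<and>
     (\<forall>x\<in>I. h x \<noteq> - ((\<Psi> x)\<^sup>2)) \<and>
     (\<exists>x\<in>I. h x + (\<Psi> x)\<^sup>2 \<noteq> deriv \<Psi> x) \<and>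
     (\<exists>x\<in>I. h x + (\<Psi> x)\<^sup>2 \<noteq> - deriv \<Psi> x)"

text \<open>\<open>csqrt\<close> is principal, so it is purely imaginary at negative reals; the integral is oriented.\<close>

definition u_top :: "(real \<Rightarrow> real) \<Rightarrow> (real \<Rightarrow> real) \<Rightarrow> real \<Rightarrow> real \<Rightarrow> complex" where
  "u_top h \<Psi> x0 x =
     exp (- (LBINT \<xi>=ereal x0..ereal x. complex_of_real (\<Psi> \<xi>) *
       ((complex_of_real (deriv \<Psi> \<xi>)
          + \<i> * csqrt (complex_of_real ((h \<xi> + (\<Psi> \<xi>)\<^sup>2)\<^sup>2 - (deriv \<Psi> \<xi>)\<^sup>2)))
        / complex_of_real (h \<xi> + (\<Psi> \<xi>)\<^sup>2))))"

definition u_bot :: "(real \<Rightarrow> real) \<Rightarrow> (real \<Rightarrow> real) \<Rightarrow> real \<Rightarrow> real \<Rightarrow> complex" where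
  "u_bot h \<Psi> x0 x =
     exp (- (LBINT \<xi>=ereal x0..ereal x. complex_of_real (\<Psi> \<xi>) *
       ((complex_of_real (deriv \<Psi> \<xi>)
          - \<i> * csqrt (complex_of_real ((h \<xi> + (\<Psi> \<xi>)\<^sup>2)\<^sup>2 - (deriv \<Psi> \<xi>)\<^sup>2)))
        / complex_of_real (h \<xi> + (\<Psi> \<xi>)\<^sup>2))))"

end

theory Submission
  imports Defs
begin

text \<open>
  Put \<open>H = h + \<Psi>\<^sup>2\<close> and \<open>Z = \<Psi> \<Psi>' / H\<close>. The equation for \<open>\<Psi>\<close> is equivalent to
  \<open>Z' = 2 Z\<^sup>2 - \<Psi>\<^sup>2 + h\<close>. The candidate solutions satisfy \<open>u' = - q u\<close> with \<open>q = Z \<plusminus> \<i> R\<close> and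
  \<open>R\<^sup>2 = \<Psi>\<^sup>2 - Z\<^sup>2\<close>, and they solve the linear equation iff \<open>q' = q\<^sup>2 + h\<close>. Adding the two Riccati
  equations gives the equation for \<open>Z\<close>. Conversely the latter implies \<open>R' = 2 Z R\<close>, hence both
  Riccati equations, with \<open>R\<close> nowhere zero, so that the Wronskian \<open>2 \<i> R u_top u_bot\<close> does not
  vanish. Local isometries with the quadric and local geodesics are
  written down in terms of a fundamental system of the linear equation.
\<close>

text \<open>The formula for \<open>Z\<close> is forced. Take two solutions of the Riccati equation
  \<open>q' = q\<^sup>2 + h\<close> and call half their sum \<open>Z\<close> and their product
  \<open>\<Psi>\<^sup>2\<close>. Differentiating the product gives
  \<open>2 \<Psi> \<Psi>' = 2 Z (\<Psi>\<^sup>2 + h)\<close>, and the two functions are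
  \<open>Z \<plusminus> \<i> R\<close> with \<open>R\<^sup>2 = \<Psi>\<^sup>2 - Z\<^sup>2\<close>.
  The candidates thus encode the sum and the product of a pair of negated logarithmic derivatives.
  The delicate point is the square root: at first \<open>R\<close> is only known to be continuous,
  it may be real or imaginary, and its branch must not jump. From solutions to the equation,
  differentiability is inherited from \<open>u' / u\<close>. In the converse direction, writing
  \<open>R\<close> as a nonzero constant times a real exponential settles differentiability, branch
  and nonvanishing at once.\<close>

lemma has_vector_derivative_scaleR_const:
  fixes e :: "'a::real_normed_vector"
  assumes "(f has_real_derivative f') (at x)"
  shows "((\<lambda>t. f t *\<^sub>R e) has_vector_derivative f' *\<^sub>R e) (at x)"
  using has_vector_derivative_scaleR[OF assms has_vector_derivative_const[of e]] by simp

text \<open>The endpoints may be infinite and \<open>x\<close> may lie on either side of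
  \<open>c\<close>, so the fundamental theorem is applied on a compact interval
  \<open>{d..e}\<close> inside the domain with both \<open>c\<close> and \<open>x\<close> in its
  interior.\<close>

lemma interval_integral_has_vector_derivative:
  fixes f :: "real \<Rightarrow> 'a::euclidean_space"
  assumes f: "continuous_on (einterval a b) f"
    and c: "c \<in> einterval a b" and x: "x \<in> einterval a b"
  shows "((\<lambda>u. LBINT y=ereal c..ereal u. f y) has_vector_derivative f x) (at x)"
proof -
  obtain d where d: "a < ereal d" "ereal d < min (ereal c) (ereal x)"
    using ereal_dense2[of a "min (ereal c) (ereal x)"] c x by (auto simp: einterval_iff)
  obtain e where e: "max (ereal c) (ereal x) < ereal e" "ereal e < b"
    using ereal_dense2[of "max (ereal c) (ereal x)" b] c x by (auto simp: einterval_iff)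
  have le: "d < c" "c < e" "d < x" "x < e"
    using d(2) e(1) by (auto simp del: min_less_iff_conj simp: min_def max_def split: if_splits)
  have "{d..e} \<subseteq> einterval a b"
  proof
    fix t assume "t \<in> {d..e}"
    then have "ereal d \<le> ereal t" "ereal t \<le> ereal e" by auto
    with d(1) e(2) show "t \<in> einterval a b"
      by (meson einterval_iff le_less_trans less_le_trans)
  qed
  then have "((\<lambda>u. LBINT y=ereal c..ereal u. f y) has_vector_derivative f x) (at x within {d..e})"
    using le by (intro interval_integral_FTC2 continuous_on_subset[OF f]) auto
  then have "((\<lambda>u. LBINT y=ereal c..ereal u. f y) has_vector_derivative f x)
      (at x within {d<..<e})"
    by (rule has_vector_derivative_within_subset) auto
  then show ?thesis
    using le has_vector_derivative_within_open[of x "{d<..<e}"] by (metis greaterThanLessThan_iff open_greaterThanLessThan)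
qed

section \<open>Second order linear equations\<close>

text \<open>A mean value estimate: integrating over a distance of at most \<open>\<delta>\<close>
  gains the factor \<open>\<delta>\<close>, the source of the geometric decay in the Picard
  series.\<close>

lemma abs_le_antiderivative_bound:
  fixes F f :: "real \<Rightarrow> real"
  assumes F: "\<And>x. x \<in> S \<Longrightarrow> (F has_real_derivative f x) (at x within S)" and "F c = 0"
    and S: "S = {c - \<delta>..c + \<delta>}" and f: "\<And>x. x \<in> S \<Longrightarrow> \<bar>f x\<bar> \<le> M" and x: "x \<in> S"
  shows "\<bar>F x\<bar> \<le> M * \<delta>"
proof -
  have c: "c \<in> S" using x S by auto
  have "norm (F x - F c) \<le> M * norm (x - c)"
    by (rule field_differentiable_bound[where S = S and f' = f]) (use F f x c S in auto)
  also have "\<dots> \<le> M * \<delta>"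
    using x S f[OF x] by (intro mult_left_mono) auto
  finally show ?thesis using \<open>F c = 0\<close> by simp
qed

text \<open>Not the Picard iterates but their increments, for the integral equation obtained by
  integrating \<open>u'' = - h u\<close> twice; the solution is their sum. The second component is
  always the derivative of the first, which suits termwise differentiation.\<close>

fun picard_term :: "(real \<Rightarrow> real) \<Rightarrow> real \<Rightarrow> real \<Rightarrow> real \<Rightarrow> nat \<Rightarrow> (real \<Rightarrow> real) \<times> (real \<Rightarrow> real)" where
  "picard_term h c \<alpha> \<beta> 0 = (\<lambda>x. \<alpha> + \<beta> * (x - c), \<lambda>x. \<beta>)"
| "picard_term h c \<alpha> \<beta> (Suc n) =
     (let v = (\<lambda>x. LBINT t=ereal c..ereal x. - h t * fst (picard_term h c \<alpha> \<beta> n) t)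
      in (\<lambda>x. LBINT t=ereal c..ereal x. v t, v))"

text \<open>By linearity the radius does not depend on the initial values, so the two members of a
  fundamental system share one interval.\<close>

lemma linear_ode2_local_existence:
  fixes h :: "real \<Rightarrow> real"
  assumes h: "continuous_on UNIV h"
  obtains \<delta> where "\<delta> > 0"
    "\<And>\<alpha> \<beta>. \<exists>u v. u c = \<alpha> \<and> v c = \<beta> \<and>
       (\<forall>x\<in>{c-\<delta><..<c+\<delta>}. (u has_real_derivative v x) (at x) \<and>
          (v has_real_derivative - h x * u x) (at x))"
proof -
  have "bounded (h ` {c-1..c+1})"
    by (intro compact_imp_bounded compact_continuous_image continuous_on_subset[OF h]) auto
  then obtain K0 where K0: "\<And>x. x \<in> {c-1..c+1} \<Longrightarrow> norm (h x) \<le> K0"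
    unfolding bounded_iff by blast
  \<comment> \<open>The maximum with 1 ensures \<open>\<delta> \<le> 1\<close>, which keeps
    \<open>S\<close> inside the interval where \<open>K0\<close> bounds \<open>h\<close>; the choice
    \<open>K * \<delta> = 1/2\<close> gives the ratio of the majorising geometric series.\<close>
  define K where "K = max K0 1"
  define \<delta> where "\<delta> = 1 / (2 * K)"
  have K: "K \<ge> 1" and \<delta>: "\<delta> > 0" "\<delta> \<le> 1" "K * \<delta> = 1/2"
    by (auto simp: K_def \<delta>_def)
  define S where "S = {c-\<delta>..c+\<delta>}"
  have hK: "\<bar>h x\<bar> \<le> K" if "x \<in> S" for x
    using K0[of x] that \<delta> by (auto simp: S_def K_def)
  have "\<exists>u v. u c = \<alpha> \<and> v c = \<beta> \<and>
       (\<forall>x\<in>{c-\<delta><..<c+\<delta>}. (u has_real_derivative v x) (at x) \<and>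
          (v has_real_derivative - h x * u x) (at x))" for \<alpha> \<beta>
  proof -
    define f where "f n = fst (picard_term h c \<alpha> \<beta> n)" for n
    define g where "g n = snd (picard_term h c \<alpha> \<beta> n)" for n
    \<comment> \<open>The derivative of \<open>g n\<close>; it is 0 for the constant
      \<open>g 0\<close>. Dropping this term shifts the index, so that the sum of the
      \<open>k n\<close> is \<open>- h\<close> times the sum of the \<open>f n\<close>.\<close>
    define k where "k n = (case n of 0 \<Rightarrow> (\<lambda>x. 0) | Suc m \<Rightarrow> (\<lambda>x. - h x * f m x))" for n
    have prim: "((\<lambda>x. LBINT t=ereal c..ereal x. w t) has_real_derivative w x) (at x)"
      if "continuous_on UNIV w" for w :: "real \<Rightarrow> real" and x
      using interval_integral_has_vector_derivative[of "-\<infinity>" \<infinity> w c x] that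
      by (simp add: has_real_derivative_iff_has_vector_derivative)
    have f0: "f 0 = (\<lambda>x. \<alpha> + \<beta> * (x - c))" and g0: "g 0 = (\<lambda>x. \<beta>)"
      and fS: "f (Suc n) = (\<lambda>x. LBINT t=ereal c..ereal x. g (Suc n) t)"
      and gS: "g (Suc n) = (\<lambda>x. LBINT t=ereal c..ereal x. k (Suc n) t)" for n
      by (auto simp: f_def g_def k_def Let_def)
    have der: "(\<forall>x. (f n has_real_derivative g n x) (at x)) \<and>
        (\<forall>x. (g n has_real_derivative k n x) (at x))" for n
    proof (induction n)
      case 0
      show ?case by (auto simp: f0 g0 k_def intro!: derivative_eq_intros)
    next
      case (Suc n)
      have "continuous_on UNIV (f n)"
        using Suc by (meson DERIV_isCont continuous_at_imp_continuous_on)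
      then have "continuous_on UNIV (k (Suc n))"
        by (auto simp: k_def intro!: continuous_intros h)
      then have g: "\<forall>x. (g (Suc n) has_real_derivative k (Suc n) x) (at x)"
        unfolding gS using prim by blast
      then have "continuous_on UNIV (g (Suc n))"
        by (meson DERIV_isCont continuous_at_imp_continuous_on)
      then show ?case
        using g prim unfolding fS by blast
    qed
    have derf: "(f n has_real_derivative g n x) (at x within T)"
      and derg: "(g n has_real_derivative k n x) (at x within T)" for n x T
      using der has_field_derivative_at_within by blast+
    define C where "C = \<bar>\<alpha>\<bar> + \<bar>\<beta>\<bar>"
    have C: "C \<ge> 0" by (simp add: C_def)
    have bnd: "(\<forall>x\<in>S. \<bar>f n x\<bar> \<le> C * (1/2)^n) \<and> (\<forall>x\<in>S. \<bar>g n x\<bar> \<le> C * (1/2)^n)" for n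
    proof (induction n)
      case 0
      have "\<bar>\<alpha> + \<beta> * (x - c)\<bar> \<le> C" if "x \<in> S" for x
      proof -
        have "\<bar>\<alpha> + \<beta> * (x - c)\<bar> \<le> \<bar>\<alpha>\<bar> + \<bar>\<beta>\<bar> * \<bar>x - c\<bar>"
          using abs_triangle_ineq[of \<alpha> "\<beta> * (x - c)"] by (simp add: abs_mult)
        also have "\<dots> \<le> \<bar>\<alpha>\<bar> + \<bar>\<beta>\<bar> * 1"
          using that \<delta> by (intro add_left_mono mult_left_mono) (auto simp: S_def)
        finally show ?thesis by (simp add: C_def)
      qed
      then show ?case by (auto simp: f0 g0 C_def)
    next
      case (Suc n)
      have zero: "f (Suc n) c = 0" "g (Suc n) c = 0" by (simp_all add: fS gS)
      have "\<bar>k (Suc n) x\<bar> \<le> K * (C * (1/2)^n)" if "x \<in> S" for x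
        using Suc hK[OF that] that K by (auto simp: k_def abs_mult intro!: mult_mono)
      then have "\<bar>g (Suc n) x\<bar> \<le> K * (C * (1/2)^n) * \<delta>" if "x \<in> S" for x
        by (rule abs_le_antiderivative_bound[OF derg zero(2) S_def]) (use that in auto)
      also have "K * (C * (1/2)^n) * \<delta> = C * (1/2)^(Suc n)"
        using \<delta>(3) by (simp add: mult_ac)
      finally have g: "\<bar>g (Suc n) x\<bar> \<le> C * (1/2)^(Suc n)" if "x \<in> S" for x
        using that by blast
      have "\<bar>f (Suc n) x\<bar> \<le> C * (1/2)^(Suc n) * \<delta>" if "x \<in> S" for x
        by (rule abs_le_antiderivative_bound[OF derf zero(1) S_def]) (use that g in auto)
      moreover have "C * (1/2)^(Suc n) * \<delta> \<le> C * (1/2)^(Suc n)"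
        using C \<delta> by (intro mult_left_le) auto
      ultimately show ?case using g by force
    qed
    have sumC: "summable (\<lambda>n. M * (1/2)^n)" for M :: real
      by (intro summable_mult summable_geometric) simp
    have ucg: "uniformly_convergent_on S (\<lambda>n x. \<Sum>i<n. g i x)"
      using bnd by (intro Weierstrass_m_test'[OF _ sumC[of C]]) auto
    \<comment> \<open>\<open>k (Suc m)\<close> is estimated through \<open>f m\<close>; the factor 2
      pays for the index shift.\<close>
    have kb: "norm (k n x) \<le> 2 * K * C * (1/2)^n" if "x \<in> S" for n x
    proof (cases n)
      case 0 then show ?thesis using K C by (simp add: k_def)
    next
      case (Suc m)
      have "\<bar>h x\<bar> * \<bar>f m x\<bar> \<le> K * (C * (1/2)^m)"
        using bnd hK[OF that] that K by (intro mult_mono) auto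
      then show ?thesis using Suc by (simp add: k_def abs_mult)
    qed
    then have uck: "uniformly_convergent_on S (\<lambda>n x. \<Sum>i<n. k i x)"
      by (intro Weierstrass_m_test'[OF _ sumC[of "2 * K * C"]]) auto
    have sumf: "summable (\<lambda>n. f n x)" and sumg: "summable (\<lambda>n. g n x)" if "x \<in> S" for x
      using bnd that by (auto intro!: summable_comparison_test'[OF sumC[of C]])
    have sumk: "summable (\<lambda>n. k n x)" if "x \<in> S" for x
      using kb[OF that] by (intro summable_comparison_test'[OF sumC[of "2 * K * C"]]) auto
    have c: "c \<in> S" using \<delta> by (simp add: S_def)
    define u where "u x = (\<Sum>n. f n x)" for x
    define v where "v x = (\<Sum>n. g n x)" for x
    have "u c = f 0 c"
      unfolding u_def using suminf_split_head[OF sumf[OF c]] by (simp add: fS)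
    moreover have "v c = g 0 c"
      unfolding v_def using suminf_split_head[OF sumg[OF c]] by (simp add: gS)
    moreover have "(u has_real_derivative v x) (at x)"
      "(v has_real_derivative - h x * u x) (at x)" if x: "x \<in> {c-\<delta><..<c+\<delta>}" for x
    proof -
      have S: "convex S" "x \<in> interior S" "x \<in> S" using x by (auto simp: S_def)
      show "(u has_real_derivative v x) (at x)"
        unfolding u_def [abs_def] v_def
        by (rule has_field_derivative_series'(2)[OF S(1) derf ucg c sumf[OF c] S(2)])
      have "(v has_real_derivative (\<Sum>n. k n x)) (at x)"
        unfolding v_def [abs_def]
        by (rule has_field_derivative_series'(2)[OF S(1) derg uck c sumg[OF c] S(2)])
      also have "(\<Sum>n. k n x) = (\<Sum>n. k (Suc n) x)"
        using suminf_split_head[OF sumk[OF S(3)]] by (simp add: k_def)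
      also have "\<dots> = - h x * u x"
        using suminf_mult[OF sumf[OF S(3)], of "- h x"] by (simp add: k_def u_def)
      finally show "(v has_real_derivative - h x * u x) (at x)" .
    qed
    ultimately show ?thesis by (intro exI[of _ u] exI[of _ v]) (simp add: f0 g0)
  qed
  with \<delta>(1) show thesis by (rule that)
qed

section \<open>Solutions of the linear equation and the equation for \<open>\<Psi>\<close>\<close>

lemma C1_differentiable_on_real_deriv:
  fixes f :: "real \<Rightarrow> real"
  assumes "f C1_differentiable_on S"
  shows "\<And>x. x \<in> S \<Longrightarrow> (f has_real_derivative deriv f x) (at x)" "continuous_on S (deriv f)"
proof -
  obtain D where D: "\<And>x. x \<in> S \<Longrightarrow> (f has_real_derivative D x) (at x)" "continuous_on S D"
    using assms by (auto simp: C1_differentiable_on_def has_real_derivative_iff_has_vector_derivative)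
  show "(f has_real_derivative deriv f x) (at x)" if "x \<in> S" for x
    using D(1)[OF that] DERIV_imp_deriv by metis
  show "continuous_on S (deriv f)"
    using D(2) D(1) DERIV_imp_deriv by (metis continuous_on_cong)
qed

lemma is_interval_einterval: "is_interval (einterval a b)"
proof -
  have "z \<in> einterval a b"
    if "x \<in> einterval a b" "y \<in> einterval a b" "x \<le> z" "z \<le> y" for x y z
    using that less_le_trans[of a "ereal x" "ereal z"] le_less_trans[of "ereal z" "ereal y" b]
    by (auto simp: einterval_iff)
  then show ?thesis unfolding is_interval_1 by blast
qed

lemma convex_einterval: "convex (einterval a b)"
  using is_interval_einterval is_interval_convex by blast

text \<open>The intermediate value theorem, used to turn pointwise sign choices for \<open>p\<close>
  and \<open>H\<close> into one choice on the whole interval.\<close>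

lemma sgn_constant_on_interval:
  fixes f :: "real \<Rightarrow> real"
  assumes "is_interval S" "continuous_on S f" "\<And>x. x \<in> S \<Longrightarrow> f x \<noteq> 0" "x \<in> S" "y \<in> S"
  shows "sgn (f x) = sgn (f y)"
proof (rule ccontr)
  assume ne: "sgn (f x) \<noteq> sgn (f y)"
  have "connected (f ` S)"
    using assms(1,2) by (intro connected_continuous_image is_interval_connected)
  then have "is_interval (f ` S)" by (simp add: is_interval_connected_1)
  moreover have "(f x \<le> 0 \<and> 0 \<le> f y) \<or> (f y \<le> 0 \<and> 0 \<le> f x)"
    using ne by (auto simp: sgn_if split: if_splits)
  ultimately have "0 \<in> f ` S"
    using assms(4,5) unfolding is_interval_1 by blast
  then show False using assms(3) by force
qed

text \<open>A nonnegative real factor can leave the principal root without changing its branch,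
  whatever the sign of \<open>e\<close>.\<close>

lemma csqrt_of_real_mult_square:
  assumes "k \<ge> 0"
  shows "csqrt (complex_of_real (e * k\<^sup>2)) = complex_of_real k * csqrt (complex_of_real e)"
proof (cases "e \<ge> 0")
  case True
  then show ?thesis using assms by (simp add: csqrt_of_real_nonneg real_sqrt_mult del: of_real_mult) (simp add: mult.commute)
next
  case False
  then have "e * k\<^sup>2 \<le> 0" by (simp add: mult_nonpos_nonneg)
  moreover have "sqrt (- (e * k\<^sup>2)) = k * sqrt (- e)"
    using assms real_sqrt_mult[of "- e" "k\<^sup>2"] by simp
  ultimately show ?thesis
    using False by (simp add: csqrt_of_real_nonpos del: of_real_mult) (simp add: mult_ac)
qed

lemma has_vector_derivative_exp_of:
  fixes F :: "real \<Rightarrow> complex"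
  assumes "(F has_vector_derivative f) (at x)"
  shows "((\<lambda>t. exp (F t)) has_vector_derivative f * exp (F x)) (at x)"
  using field_vector_diff_chain_at[OF assms DERIV_exp] by (simp add: o_def)

lemma has_vector_derivative_of_real_complex:
  assumes "(f has_real_derivative f') (at x)"
  shows "((\<lambda>t. complex_of_real (f t)) has_vector_derivative complex_of_real f') (at x)"
  using assms has_vector_derivative_of_real[of f f' "at x", where ?'a = complex]
  by (simp add: has_real_derivative_iff_has_vector_derivative)

section \<open>Wronskians and fundamental systems\<close>

lemma wronskian_constant:
  fixes v w :: "real \<Rightarrow> complex"
  assumes S: "convex S"
    and v: "\<And>x. x \<in> S \<Longrightarrow> (v has_vector_derivative v' x) (at x)"
      "\<And>x. x \<in> S \<Longrightarrow> (v' has_vector_derivative - complex_of_real (h x) * v x) (at x)"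
    and w: "\<And>x. x \<in> S \<Longrightarrow> (w has_vector_derivative w' x) (at x)"
      "\<And>x. x \<in> S \<Longrightarrow> (w' has_vector_derivative - complex_of_real (h x) * w x) (at x)"
  obtains c where "\<And>x. x \<in> S \<Longrightarrow> v x * w' x - w x * v' x = c"
proof -
  have "((\<lambda>x. v x * w' x - w x * v' x) has_vector_derivative 0) (at x within S)" if "x \<in> S" for x
    using has_vector_derivative_diff[OF has_vector_derivative_mult[OF v(1)[OF that] w(2)[OF that]]
        has_vector_derivative_mult[OF w(1)[OF that] v(2)[OF that]]]
    by (auto simp: algebra_simps intro: has_vector_derivative_at_within)
  from has_vector_derivative_zero_constant[OF S this] show thesis
    using that by blast
qed

text \<open>Cramer's rule in place of a uniqueness theorem:
  \<open>u (v w' - w v') = (u w' - w u') v + (v u' - u v') w\<close> is an identity, and all three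
  Wronskians in it are constant, so their quotients are the coefficients \<open>A\<close> and
  \<open>B\<close>.\<close>

lemma general_solutionI:
  assumes S: "convex S" and c: "c \<in> S"
    and v: "\<And>x. x \<in> S \<Longrightarrow> (v has_vector_derivative v' x) (at x)"
      "\<And>x. x \<in> S \<Longrightarrow> (v' has_vector_derivative - complex_of_real (h x) * v x) (at x)"
    and w: "\<And>x. x \<in> S \<Longrightarrow> (w has_vector_derivative w' x) (at x)"
      "\<And>x. x \<in> S \<Longrightarrow> (w' has_vector_derivative - complex_of_real (h x) * w x) (at x)"
    and nz: "v c * w' c - w c * v' c \<noteq> 0"
    and S': "open S"
  shows "general_solution h S v w"
  unfolding general_solution_def
proof (intro allI iffI)
  fix u assume "is_solution h S u"
  then obtain u' u'' where u: "\<And>x. x \<in> S \<Longrightarrow> (u has_vector_derivative u' x) (at x)"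
      "\<And>x. x \<in> S \<Longrightarrow> (u' has_vector_derivative u'' x) (at x)"
      "\<And>x. x \<in> S \<Longrightarrow> u'' x + complex_of_real (h x) * u x = 0"
    unfolding is_solution_def by metis
  have u2: "(u' has_vector_derivative - complex_of_real (h x) * u x) (at x)" if "x \<in> S" for x
    using u(2,3)[OF that] by (simp add: eq_neg_iff_add_eq_0[symmetric])
  obtain k1 where k1: "\<And>x. x \<in> S \<Longrightarrow> v x * w' x - w x * v' x = k1"
    using wronskian_constant[OF S v w] by metis
  obtain k2 where k2: "\<And>x. x \<in> S \<Longrightarrow> u x * w' x - w x * u' x = k2"
    using wronskian_constant[OF S u(1) u2 w] by metis
  obtain k3 where k3: "\<And>x. x \<in> S \<Longrightarrow> v x * u' x - u x * v' x = k3"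
    using wronskian_constant[OF S v u(1) u2] by metis
  have "k1 \<noteq> 0" using nz k1[OF c] by simp
  have "u x = k2 / k1 * v x + k3 / k1 * w x" if "x \<in> S" for x
  proof -
    have "u x * k1 = k2 * v x + k3 * w x"
      unfolding k1[OF that, symmetric] k2[OF that, symmetric] k3[OF that, symmetric]
      by (simp add: algebra_simps)
    then show ?thesis using \<open>k1 \<noteq> 0\<close> by (simp add: field_simps)
  qed
  then show "\<exists>A B. \<forall>x\<in>S. u x = A * v x + B * w x" by blast
next
  fix u assume "\<exists>A B. \<forall>x\<in>S. u x = A * v x + B * w x"
  then obtain A B where u: "\<And>x. x \<in> S \<Longrightarrow> u x = A * v x + B * w x" by blast
  have lin: "((\<lambda>x. A * f x + B * g x) has_vector_derivative A * f' + B * g') (at x)"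
    if "(f has_vector_derivative f') (at x)" "(g has_vector_derivative g') (at x)" for f g f' g' x
    using that by (intro has_vector_derivative_add has_vector_derivative_mult_right)
  show "is_solution h S u"
    unfolding is_solution_def
  proof (intro exI ballI conjI)
    fix x assume x: "x \<in> S"
    show "(u has_vector_derivative A * v' x + B * w' x) (at x)"
      by (rule has_vector_derivative_transform_within_open[OF lin[OF v(1)[OF x] w(1)[OF x]] S' x])
        (simp add: u)
    show "((\<lambda>x. A * v' x + B * w' x) has_vector_derivative
        A * (- complex_of_real (h x) * v x) + B * (- complex_of_real (h x) * w x)) (at x)"
      by (rule lin[OF v(2)[OF x] w(2)[OF x]])
    show "A * (- complex_of_real (h x) * v x) + B * (- complex_of_real (h x) * w x)
        + complex_of_real (h x) * u x = 0"
      by (simp add: u[OF x] algebra_simps)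
  qed
qed

section \<open>The Riccati equations along an admissible curve\<close>

locale admissible_curve =
  fixes h \<Psi> :: "real \<Rightarrow> real" and a b :: ereal and x0 :: real
  assumes h_C1: "h C1_differentiable_on UNIV"
    and x0: "x0 \<in> einterval a b"
    and admissible: "admissible h (einterval a b) \<Psi>"
begin

abbreviation I :: "real set" where "I \<equiv> einterval a b"

abbreviation p :: "real \<Rightarrow> real" where "p \<equiv> deriv \<Psi>"

definition H :: "real \<Rightarrow> real" where "H x = h x + (\<Psi> x)\<^sup>2"

text \<open>The logarithmic derivatives of the two candidate solutions are \<open>- (Z \<plusminus> \<i> R)\<close>.\<close>

definition Z :: "real \<Rightarrow> real" where "Z x = \<Psi> x * p x / H x"

definition R :: "real \<Rightarrow> complex" where
  "R x = complex_of_real (\<Psi> x) * csqrt (complex_of_real ((H x)\<^sup>2 - (p x)\<^sup>2)) / complex_of_real (H x)"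

definition u :: "complex \<Rightarrow> real \<Rightarrow> complex" where
  "u \<sigma> x = exp (- (LBINT \<xi>=ereal x0..ereal x. complex_of_real (Z \<xi>) + \<sigma> * R \<xi>))"

lemma der_h: "(h has_real_derivative deriv h x) (at x)"
  using C1_differentiable_on_real_deriv(1)[OF h_C1] by simp

lemma cont_h: "continuous_on S h" and cont_deriv_h: "continuous_on S (deriv h)"
  using der_h C1_differentiable_on_real_deriv(2)[OF h_C1]
  by (auto intro: DERIV_continuous_on continuous_on_subset has_field_derivative_at_within)

lemma der_\<Psi>: "x \<in> I \<Longrightarrow> (\<Psi> has_real_derivative p x) (at x)"
  and der_p: "x \<in> I \<Longrightarrow> (p has_real_derivative deriv p x) (at x)"
  using admissible C1_differentiable_on_real_deriv
  unfolding admissible_def C2_differentiable_on_def by blast+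

lemma cont_\<Psi>: "continuous_on I \<Psi>" and cont_p: "continuous_on I p"
  using der_\<Psi> der_p by (meson DERIV_isCont continuous_at_imp_continuous_on)+

lemma \<Psi>_pos: "x \<in> I \<Longrightarrow> \<Psi> x > 0" and H_nz: "x \<in> I \<Longrightarrow> H x \<noteq> 0"
  using admissible by (auto simp: admissible_def H_def add_eq_0_iff2)

lemma cont_H: "continuous_on I H"
  unfolding H_def[abs_def] by (intro continuous_intros cont_h cont_\<Psi>)

lemma der_H: "x \<in> I \<Longrightarrow> (H has_real_derivative deriv h x + 2 * \<Psi> x * p x) (at x)"
  unfolding H_def[abs_def] by (auto intro!: derivative_eq_intros der_h der_\<Psi>)

lemma cont_Z: "continuous_on I Z"
  unfolding Z_def[abs_def] using H_nz by (intro continuous_intros cont_H cont_\<Psi> cont_p) auto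

lemma der_Z:
  assumes "x \<in> I"
  shows "(Z has_real_derivative
    ((p x)\<^sup>2 + \<Psi> x * deriv p x) / H x - \<Psi> x * p x * (deriv h x + 2 * \<Psi> x * p x) / (H x)\<^sup>2) (at x)"
  unfolding Z_def[abs_def] using H_nz[OF assms]
  by (auto intro!: derivative_eq_intros der_H der_p der_\<Psi> assms simp: field_simps power2_eq_square)

text \<open>\<open>\<Psi>''\<close> enters \<open>Z'\<close> with the coefficient
  \<open>\<Psi> / H\<close>, and the defect of the equation for \<open>Z\<close> is exactly this
  nowhere vanishing factor times the defect of the equation for \<open>\<Psi>\<close>.\<close>

lemma explicit_geodesic_equation_iff:
  "explicit_geodesic_equation h I \<Psi> \<longleftrightarrow>
     (\<forall>x\<in>I. (Z has_real_derivative 2 * (Z x)\<^sup>2 - (\<Psi> x)\<^sup>2 + h x) (at x))"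
  unfolding explicit_geodesic_equation_def
proof (rule ball_cong[OF refl])
  fix x assume x: "x \<in> I"
  let ?lhs = "((p x)\<^sup>2 + \<Psi> x * deriv p x) / H x - \<Psi> x * p x * (deriv h x + 2 * \<Psi> x * p x) / (H x)\<^sup>2"
  let ?rhs = "(3 * (\<Psi> x)\<^sup>2 - h x) / ((\<Psi> x)\<^sup>2 + h x) * ((p x)\<^sup>2 / \<Psi> x)
        + deriv h x * p x / ((\<Psi> x)\<^sup>2 + h x) - ((\<Psi> x) ^ 4 - (h x)\<^sup>2) / \<Psi> x"
  have \<Psi>: "(\<Psi> x)\<^sup>2 + h x = H x" "h x = H x - (\<Psi> x)\<^sup>2" by (auto simp: H_def)
  have "(\<Psi> x) ^ 4 - (h x)\<^sup>2 = H x * (2 * (\<Psi> x)\<^sup>2 - H x)"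
    by (simp add: H_def power2_eq_square power4_eq_xxxx algebra_simps)
  then have "?lhs - (2 * (Z x)\<^sup>2 - (\<Psi> x)\<^sup>2 + h x) = \<Psi> x / H x * (deriv p x - ?rhs)"
    using H_nz[OF x] \<Psi>_pos[OF x] unfolding \<Psi>(1) Z_def unfolding \<Psi>(2)
    by (simp add: power_divide power_mult_distrib add_divide_distrib diff_divide_distrib
        power2_eq_square algebra_simps)
  then have "deriv p x = ?rhs \<longleftrightarrow> ?lhs = 2 * (Z x)\<^sup>2 - (\<Psi> x)\<^sup>2 + h x"
    using H_nz[OF x] \<Psi>_pos[OF x]
    by (metis divide_eq_0_iff less_irrefl mult_eq_0_iff right_minus_eq)
  also have "\<dots> \<longleftrightarrow> (Z has_real_derivative 2 * (Z x)\<^sup>2 - (\<Psi> x)\<^sup>2 + h x) (at x)"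
    using der_Z[OF x] DERIV_unique by metis
  finally show "deriv p x = ?rhs \<longleftrightarrow>
      (Z has_real_derivative 2 * (Z x)\<^sup>2 - (\<Psi> x)\<^sup>2 + h x) (at x)" .
qed

text \<open>Squaring erases the branch of the root and the sign of \<open>H\<close>, so real and
  imaginary \<open>R\<close> obey the same identity.\<close>

lemma R_square:
  assumes "x \<in> I"
  shows "(R x)\<^sup>2 = complex_of_real ((\<Psi> x)\<^sup>2 - (Z x)\<^sup>2)"
proof -
  have "(\<Psi> x)\<^sup>2 * ((H x)\<^sup>2 - (p x)\<^sup>2) / (H x)\<^sup>2 = (\<Psi> x)\<^sup>2 - (Z x)\<^sup>2"
    using H_nz[OF assms] by (simp add: Z_def field_simps)
  then have "complex_of_real ((\<Psi> x)\<^sup>2 - (Z x)\<^sup>2) =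
      (complex_of_real (\<Psi> x))\<^sup>2 * complex_of_real ((H x)\<^sup>2 - (p x)\<^sup>2) / (complex_of_real (H x))\<^sup>2"
    by (metis of_real_divide of_real_mult of_real_power)
  then show ?thesis
    by (simp add: R_def power_mult_distrib power_divide)
qed

text \<open>The negative axis is the branch cut of \<open>csqrt\<close>, but along the real line
  itself the root only turns from real to imaginary at 0, where both parts vanish.\<close>

lemma cont_csqrt_of_real: "continuous_on S (\<lambda>x. csqrt (complex_of_real x))"
proof -
  have "csqrt (complex_of_real x) = complex_of_real (sqrt (max x 0)) + \<i> * complex_of_real (sqrt (max (- x) 0))" for x
    by (cases "x \<ge> 0") (simp_all add: csqrt_of_real_nonneg csqrt_of_real_nonpos max_def)
  then show ?thesis
    by (simp only:) (intro continuous_intros)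
qed

lemma cont_R: "continuous_on I R"
  unfolding R_def[abs_def] using H_nz
  by (intro continuous_intros continuous_on_compose2[OF cont_csqrt_of_real[of UNIV]] cont_H cont_\<Psi> cont_p) auto

lemma u_top_eq: "u_top h \<Psi> x0 = u \<i>" and u_bot_eq: "u_bot h \<Psi> x0 = u (- \<i>)"
  by (auto simp: fun_eq_iff u_top_def u_bot_def u_def Z_def R_def H_def algebra_simps add_divide_distrib
      diff_divide_distrib)

lemma has_vector_derivative_u:
  assumes x: "x \<in> I"
  shows "(u \<sigma> has_vector_derivative - (complex_of_real (Z x) + \<sigma> * R x) * u \<sigma> x) (at x)"
proof -
  have "continuous_on I (\<lambda>x. complex_of_real (Z x) + \<sigma> * R x)"
    by (intro continuous_intros cont_Z cont_R)
  from has_vector_derivative_exp_of[OF has_vector_derivative_minus[OF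
      interval_integral_has_vector_derivative[OF this x0 x]]]
  show ?thesis unfolding u_def[abs_def] .
qed

text \<open>The integrand is so far only continuous. It equals \<open>- u' / u\<close>, and
  \<open>u'\<close> is differentiable because \<open>u\<close> is a solution, so the integrand is
  differentiable too.\<close>

lemma u_solution_imp_riccati:
  assumes "is_solution h I (u \<sigma>)" and x: "x \<in> I"
  shows "((\<lambda>x. complex_of_real (Z x) + \<sigma> * R x) has_vector_derivative
    (complex_of_real (Z x) + \<sigma> * R x)\<^sup>2 + complex_of_real (h x)) (at x)"
proof -
  define q where "q x = complex_of_real (Z x) + \<sigma> * R x" for x
  obtain u' u'' where u: "\<And>x. x \<in> I \<Longrightarrow> (u \<sigma> has_vector_derivative u' x) (at x)"
      "\<And>x. x \<in> I \<Longrightarrow> (u' has_vector_derivative u'' x) (at x)"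
      "\<And>x. x \<in> I \<Longrightarrow> u'' x + complex_of_real (h x) * u \<sigma> x = 0"
    using assms(1) unfolding is_solution_def by metis
  \<comment> \<open>The reciprocal of \<open>u \<sigma>\<close> as an explicit exponential, which
    turns the quotient into a product.\<close>
  define w where "w x = exp (LBINT \<xi>=ereal x0..ereal x. q \<xi>)" for x
  have uw: "u \<sigma> x * w x = 1" for x
    by (simp add: u_def w_def q_def exp_minus)
  have "continuous_on I q"
    unfolding q_def by (intro continuous_intros cont_Z cont_R)
  then have w: "(w has_vector_derivative q x * w x) (at x)"
    unfolding w_def[abs_def]
    by (rule has_vector_derivative_exp_of[OF interval_integral_has_vector_derivative[OF _ x0 x]])
  have u': "u' y = - q y * u \<sigma> y" if "y \<in> I" for y
    using vector_derivative_unique_at[OF u(1)[OF that] has_vector_derivative_u[OF that]]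
    by (simp add: q_def)
  have "((\<lambda>y. - (u' y * w y)) has_vector_derivative - (u' x * (q x * w x) + u'' x * w x)) (at x)"
    by (intro has_vector_derivative_minus has_vector_derivative_mult u(2) x w)
  also have "- (u' x * (q x * w x) + u'' x * w x) =
      (q x)\<^sup>2 * (u \<sigma> x * w x) + complex_of_real (h x) * (u \<sigma> x * w x)"
    using u(3)[OF x] u'[OF x] by (simp add: eq_neg_iff_add_eq_0[symmetric] algebra_simps power2_eq_square)
  finally have "((\<lambda>y. - (u' y * w y)) has_vector_derivative (q x)\<^sup>2 + complex_of_real (h x)) (at x)"
    by (simp add: uw)
  then have "(q has_vector_derivative (q x)\<^sup>2 + complex_of_real (h x)) (at x)"
  proof (rule has_vector_derivative_transform_within_open[OF _ open_einterval x])
    show "- (u' y * w y) = q y" if "y \<in> I" for y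
      using u'[OF that] uw[of y] by (simp add: mult.assoc)
  qed
  then show ?thesis by (simp add: q_def[abs_def])
qed

lemma general_solution_imp_equation:
  assumes "general_solution h I (u_top h \<Psi> x0) (u_bot h \<Psi> x0)"
  shows "explicit_geodesic_equation h I \<Psi>"
  unfolding explicit_geodesic_equation_iff
proof
  fix x assume x: "x \<in> I"
  have "\<exists>A B. \<forall>x\<in>I. u \<i> x = A * u \<i> x + B * u (- \<i>) x"
    by (rule exI[of _ 1], rule exI[of _ 0]) simp
  then have top: "is_solution h I (u \<i>)"
    using assms unfolding general_solution_def u_top_eq u_bot_eq by blast
  have "\<exists>A B. \<forall>x\<in>I. u (- \<i>) x = A * u \<i> x + B * u (- \<i>) x"
    by (rule exI[of _ 0], rule exI[of _ 1]) simp
  then have bot: "is_solution h I (u (- \<i>))"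
    using assms unfolding general_solution_def u_top_eq u_bot_eq by blast
  \<comment> \<open>\<open>R\<close> cancels in the sum, so the average is \<open>Z\<close>; taking
    real parts leads back to a real derivative.\<close>
  have "((\<lambda>x. Re ((complex_of_real (Z x) + \<i> * R x) + (complex_of_real (Z x) + - \<i> * R x)) / 2)
      has_vector_derivative
      Re (((complex_of_real (Z x) + \<i> * R x)\<^sup>2 + complex_of_real (h x)) +
       ((complex_of_real (Z x) + - \<i> * R x)\<^sup>2 + complex_of_real (h x))) / 2) (at x)"
    by (intro bounded_linear.has_vector_derivative[OF bounded_linear_divide]
        bounded_linear.has_vector_derivative[OF bounded_linear_Re]
        has_vector_derivative_add u_solution_imp_riccati top bot x)
  also have "((complex_of_real (Z x) + \<i> * R x)\<^sup>2 + complex_of_real (h x)) +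
       ((complex_of_real (Z x) + - \<i> * R x)\<^sup>2 + complex_of_real (h x)) =
       2 * (complex_of_real (Z x))\<^sup>2 - 2 * (R x)\<^sup>2 + 2 * complex_of_real (h x)"
    by (simp add: power2_eq_square algebra_simps)
  also have "\<dots> = complex_of_real (2 * (2 * (Z x)\<^sup>2 - (\<Psi> x)\<^sup>2 + h x))"
    by (simp add: R_square[OF x] algebra_simps)
  finally show "(Z has_real_derivative 2 * (Z x)\<^sup>2 - (\<Psi> x)\<^sup>2 + h x) (at x)"
    by (simp add: has_real_derivative_iff_has_vector_derivative add_divide_distrib diff_divide_distrib)
qed

text \<open>The quantity \<open>E = \<Psi>\<^sup>2 - Z\<^sup>2\<close> under the square root satisfies \<open>E' = 4 Z E\<close>, so it either
  vanishes identically, which the two non-identity hypotheses exclude, or never vanishes.\<close>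

lemma R_exponential:
  assumes "explicit_geodesic_equation h I \<Psi>"
  obtains G c where "\<And>x. x \<in> I \<Longrightarrow> (G has_real_derivative Z x) (at x)" "c \<noteq> 0"
    "\<And>x. x \<in> I \<Longrightarrow> R x = c * complex_of_real (exp (2 * G x))"
proof -
  define G where "G x = (LBINT t=ereal x0..ereal x. Z t)" for x
  have G: "(G has_real_derivative Z x) (at x)" if "x \<in> I" for x
    using interval_integral_has_vector_derivative[OF cont_Z x0 that]
    by (simp add: G_def[abs_def] has_real_derivative_iff_has_vector_derivative)
  define E where "E x = (\<Psi> x)\<^sup>2 - (Z x)\<^sup>2" for x
  have der_Z': "(Z has_real_derivative 2 * (Z x)\<^sup>2 - (\<Psi> x)\<^sup>2 + h x) (at x)" if "x \<in> I" for x
    using assms that unfolding explicit_geodesic_equation_iff by blast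
  have E: "(E has_real_derivative 4 * Z x * E x) (at x)" if x: "x \<in> I" for x
  proof -
    have "(E has_real_derivative 2 * (\<Psi> x * p x) - 2 * Z x * (2 * (Z x)\<^sup>2 - (\<Psi> x)\<^sup>2 + h x)) (at x)"
      unfolding E_def[abs_def] by (auto intro!: derivative_eq_intros der_Z' der_\<Psi> x)
    also have "\<Psi> x * p x = Z x * H x"
      using H_nz[OF x] by (simp add: Z_def)
    finally show ?thesis
      by (rule DERIV_cong) (simp add: E_def H_def algebra_simps power2_eq_square)
  qed
  \<comment> \<open>Integrating factor for \<open>E' = 4 Z E\<close>, as
    \<open>G' = Z\<close>.\<close>
  have "((\<lambda>x. E x * exp (- 4 * G x)) has_real_derivative 0) (at x within I)" if "x \<in> I" for x
    by (rule has_field_derivative_at_within)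
      (auto intro!: derivative_eq_intros E G that simp: algebra_simps)
  then have "\<exists>e. \<forall>x\<in>I. E x * exp (- 4 * G x) = e"
    by (intro has_field_derivative_zero_constant[OF convex_einterval])
  then obtain e where e: "\<And>x. x \<in> I \<Longrightarrow> E x * exp (- 4 * G x) = e"
    by blast
  have Ee: "E x = e * (exp (2 * G x))\<^sup>2" if "x \<in> I" for x
  proof -
    have "E x = (E x * exp (- 4 * G x)) * exp (4 * G x)"
      by (simp add: mult.assoc exp_add[symmetric])
    also have "exp (4 * G x) = (exp (2 * G x))\<^sup>2"
      using exp_double[of "2 * G x"] by simp
    finally show ?thesis unfolding e[OF that] .
  qed
  \<comment> \<open>The absolute value makes \<open>\<bar>H x\<bar> / \<Psi> x\<close> a nonnegative
    factor that can leave the principal root. Dividing by \<open>H\<close> in \<open>R\<close> then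
    leaves only the sign of \<open>H\<close>, which is constant.\<close>
  have HE: "(H x)\<^sup>2 - (p x)\<^sup>2 = E x * (\<bar>H x\<bar> / \<Psi> x)\<^sup>2" if "x \<in> I" for x
    using H_nz[OF that] \<Psi>_pos[OF that] by (simp add: E_def Z_def field_simps)
  \<comment> \<open>If \<open>e = 0\<close>, then \<open>\<bar>p\<bar> = \<bar>H\<bar>\<close>
    pointwise. Both functions are continuous without zeros, so the relative sign cannot switch, and
    one of the two identities excluded by \<open>admissible\<close> would hold throughout.\<close>
  have "e \<noteq> 0"
  proof
    assume "e = 0"
    then have pH: "\<bar>p x\<bar> = \<bar>H x\<bar>" if "x \<in> I" for x
      using HE[OF that] Ee[OF that] by (simp add: abs_eq_iff power2_eq_iff) argo
    then have "p x = sgn (p x0) * sgn (H x0) * H x" if "x \<in> I" for x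
    proof -
      have "sgn (p x) = sgn (p x0)"
        by (rule sgn_constant_on_interval[OF is_interval_einterval cont_p _ that x0])
          (use pH H_nz in force)
      moreover have "sgn (H x) = sgn (H x0)"
        by (rule sgn_constant_on_interval[OF is_interval_einterval cont_H H_nz that x0])
      moreover have "p x = sgn (p x) * \<bar>H x\<bar>" "\<bar>H x\<bar> = sgn (H x) * H x"
        using pH[OF that] sgn_mult_abs[of "p x"] abs_sgn[of "H x"] by (simp_all add: mult.commute)
      ultimately show ?thesis by simp
    qed
    moreover have "sgn (p x0) * sgn (H x0) \<in> {1, -1}"
      using pH[OF x0] H_nz[OF x0] by (auto simp: sgn_if)
    ultimately have "(\<forall>x\<in>I. H x = p x) \<or> (\<forall>x\<in>I. H x = - p x)" by auto
    then show False using admissible by (auto simp: admissible_def H_def)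
  qed
  have R: "R x = (complex_of_real (sgn (H x0)) * csqrt (complex_of_real e)) * complex_of_real (exp (2 * G x))"
    if x: "x \<in> I" for x
  proof -
    have sgn: "sgn (H x) = sgn (H x0)"
      by (rule sgn_constant_on_interval[OF is_interval_einterval cont_H H_nz x x0])
    have "(H x)\<^sup>2 - (p x)\<^sup>2 = e * (exp (2 * G x) * (\<bar>H x\<bar> / \<Psi> x))\<^sup>2"
      unfolding HE[OF x] Ee[OF x] by (simp only: power_mult_distrib mult.assoc)
    then have *: "csqrt (complex_of_real ((H x)\<^sup>2 - (p x)\<^sup>2)) =
        complex_of_real (exp (2 * G x) * (\<bar>H x\<bar> / \<Psi> x)) * csqrt (complex_of_real e)"
      using \<Psi>_pos[OF x] by (simp only:) (rule csqrt_of_real_mult_square, simp)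
    have "\<Psi> x * (exp (2 * G x) * (\<bar>H x\<bar> / \<Psi> x)) / H x = sgn (H x0) * exp (2 * G x)"
      using \<Psi>_pos[OF x] H_nz[OF x] abs_sgn[of "H x"] sgn by simp
    then have "complex_of_real (\<Psi> x) * complex_of_real (exp (2 * G x) * (\<bar>H x\<bar> / \<Psi> x)) / complex_of_real (H x)
        = complex_of_real (sgn (H x0)) * complex_of_real (exp (2 * G x))"
      by (metis of_real_divide of_real_mult)
    moreover have "R x = complex_of_real (\<Psi> x) * complex_of_real (exp (2 * G x) * (\<bar>H x\<bar> / \<Psi> x))
        / complex_of_real (H x) * csqrt (complex_of_real e)"
      unfolding R_def * by (simp only: times_divide_eq_left mult.assoc)
    ultimately show ?thesis by (simp only: mult_ac)
  qed
  show thesis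
    by (rule that[OF G _ R]) (use \<open>e \<noteq> 0\<close> H_nz[OF x0] in \<open>auto simp: sgn_if\<close>)
qed

lemma equation_imp_general_solution:
  assumes eq: "explicit_geodesic_equation h I \<Psi>"
  shows "general_solution h I (u_top h \<Psi> x0) (u_bot h \<Psi> x0)"
proof -
  obtain G c where G: "\<And>x. x \<in> I \<Longrightarrow> (G has_real_derivative Z x) (at x)" and c: "c \<noteq> 0"
    and R: "\<And>x. x \<in> I \<Longrightarrow> R x = c * complex_of_real (exp (2 * G x))"
    using R_exponential[OF eq] by metis
  have der_R: "(R has_vector_derivative 2 * complex_of_real (Z x) * R x) (at x)" if x: "x \<in> I" for x
  proof -
    have "((\<lambda>x. exp (2 * G x)) has_real_derivative 2 * Z x * exp (2 * G x)) (at x)"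
      by (auto intro!: derivative_eq_intros G x)
    from has_vector_derivative_mult_right[OF has_vector_derivative_of_real_complex[OF this], of c]
    have "((\<lambda>x. c * complex_of_real (exp (2 * G x))) has_vector_derivative
        2 * complex_of_real (Z x) * R x) (at x)"
      by (simp add: R[OF x] mult_ac)
    then show ?thesis
      by (rule has_vector_derivative_transform_within_open[OF _ open_einterval x]) (simp add: R)
  qed
  \<comment> \<open>Only \<open>\<sigma>\<^sup>2 = -1\<close> matters, so both signs of the root are
    treated at once; the functions here are the logarithmic derivatives
    \<open>u' / u\<close>.\<close>
  have riccati: "((\<lambda>x. - (complex_of_real (Z x) + \<sigma> * R x)) has_vector_derivative
    - ((complex_of_real (Z x) + \<sigma> * R x)\<^sup>2 + complex_of_real (h x))) (at x)"
    if x: "x \<in> I" and \<sigma>: "\<sigma>\<^sup>2 = -1" for x \<sigma>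
  proof -
    have "(Z has_real_derivative 2 * (Z x)\<^sup>2 - (\<Psi> x)\<^sup>2 + h x) (at x)"
      using eq x unfolding explicit_geodesic_equation_iff by blast
    from has_vector_derivative_minus[OF has_vector_derivative_add[OF
        has_vector_derivative_of_real_complex[OF this]
        has_vector_derivative_mult_right[OF der_R[OF x], of \<sigma>]]]
    show ?thesis
    proof (rule has_vector_derivative_eq_rhs)
      have "(complex_of_real (Z x) + \<sigma> * R x)\<^sup>2 =
          (complex_of_real (Z x))\<^sup>2 + \<sigma>\<^sup>2 * (R x)\<^sup>2 + 2 * complex_of_real (Z x) * \<sigma> * R x"
        by (simp add: power2_eq_square algebra_simps)
      then show "- (complex_of_real (2 * (Z x)\<^sup>2 - (\<Psi> x)\<^sup>2 + h x) + \<sigma> * (2 * complex_of_real (Z x) * R x)) =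
          - ((complex_of_real (Z x) + \<sigma> * R x)\<^sup>2 + complex_of_real (h x))"
        by (simp add: R_square[OF x] \<sigma> algebra_simps)
    qed
  qed
  have u2: "((\<lambda>x. - (complex_of_real (Z x) + \<sigma> * R x) * u \<sigma> x) has_vector_derivative
      - complex_of_real (h x) * u \<sigma> x) (at x)"
    if "x \<in> I" "\<sigma>\<^sup>2 = -1" for x \<sigma>
    by (rule has_vector_derivative_eq_rhs[OF has_vector_derivative_mult[OF riccati[OF that]
          has_vector_derivative_u[OF that(1)]]])
      (simp add: algebra_simps power2_eq_square)
  \<comment> \<open>Both candidates equal 1 at \<open>x0\<close>, so their Wronskian there is
    \<open>2 \<i> R x0\<close>.\<close>
  have "R x0 \<noteq> 0" using c by (simp add: R[OF x0])
  then show ?thesis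
    unfolding u_top_eq u_bot_eq
    by (intro general_solutionI[OF convex_einterval x0 has_vector_derivative_u u2
          has_vector_derivative_u u2]) (auto simp: algebra_simps u_def)
qed

end

section \<open>Geodesics in explicit form\<close>

lemma matrix_inv_eqI:
  fixes A B :: "real ^ 'n ^ 'n"
  assumes "A ** B = mat 1"
  shows "matrix_inv A = B"
proof -
  have "B ** A = mat 1" using assms matrix_left_right_inverse by blast
  then have "matrix_inv A ** A = mat 1"
    using assms someI_ex[of "\<lambda>A'. A ** A' = mat 1 \<and> A' ** A = mat 1"]
    unfolding matrix_inv_def by blast
  then have "matrix_inv A ** (A ** B) = B" by (simp add: matrix_mul_assoc)
  then show ?thesis by (simp add: assms)
qed

lemma metric_h_nth:
  "metric_h h q $ 1 $ 1 = - ((h (q $ 1) + (q $ 2)\<^sup>2)\<^sup>2) / (q $ 2)\<^sup>2" "metric_h h q $ 1 $ 2 = 0"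
  "metric_h h q $ 2 $ 1 = 0" "metric_h h q $ 2 $ 2 = 1 / (q $ 2)\<^sup>2"
  by (simp_all add: metric_h_def vector_2)

lemma axis_2_nth:
  "axis (1::2) x $ 1 = x" "axis (1::2) x $ 2 = 0" "axis (2::2) x $ 1 = 0" "axis (2::2) x $ 2 = x"
  by (simp_all add: axis_def)

text \<open>The metric is diagonal with entries \<open>- (H / y)\<^sup>2\<close> and
  \<open>1 / y\<^sup>2\<close>. The recurring term \<open>2 * y\<^sup>2 - H\<close> is
  \<open>y\<^sup>2\<close> times the derivative of \<open>H / y\<close> in \<open>y\<close>.\<close>

lemma christoffel_metric_h:
  fixes q :: "real ^ 2"
  assumes q: "q \<in> H0 h" and h: "(h has_real_derivative h') (at (q $ 1))"
  defines "H \<equiv> h (q $ 1) + (q $ 2)\<^sup>2" and "y \<equiv> q $ 2"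
  shows "christoffel (metric_h h) 1 1 1 q = h' / H"
    "christoffel (metric_h h) 1 1 2 q = (2 * y\<^sup>2 - H) / (y * H)"
    "christoffel (metric_h h) 1 2 1 q = (2 * y\<^sup>2 - H) / (y * H)"
    "christoffel (metric_h h) 1 2 2 q = 0"
    "christoffel (metric_h h) 2 1 1 q = H * (2 * y\<^sup>2 - H) / y"
    "christoffel (metric_h h) 2 1 2 q = 0"
    "christoffel (metric_h h) 2 2 1 q = 0"
    "christoffel (metric_h h) 2 2 2 q = - 1 / y"
proof -
  have y: "y > 0" and H: "H \<noteq> 0" using q by (auto simp: H0_def y_def H_def)
  have hq: "h (q $ 1) + y\<^sup>2 = H" by (simp add: H_def y_def)
  have inv: "matrix_inv (metric_h h q) = vector [vector [- y\<^sup>2 / H\<^sup>2, 0], vector [0, y\<^sup>2]]"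
    using y H
    by (intro matrix_inv_eqI)
      (simp add: vec_eq_iff forall_2 matrix_matrix_mult_def sum_2 vector_2 metric_h_nth mat_def
        y_def[symmetric] hq)
  have h_shift: "((\<lambda>t. h (q $ 1 + t)) has_real_derivative h') (at 0)"
    using DERIV_shift[of h h' 0 "q $ 1"] h by (simp add: add.commute)
  have d11: "partial_deriv 1 (\<lambda>q. metric_h h q $ 1 $ 1) q = - 2 * H * h' / y\<^sup>2"
    unfolding partial_deriv_def
  proof (rule DERIV_imp_deriv)
    have "((\<lambda>t. - ((h (q $ 1 + t) + y\<^sup>2)\<^sup>2) / y\<^sup>2) has_real_derivative - 2 * H * h' / y\<^sup>2) (at 0)"
      using y by (auto intro!: derivative_eq_intros h_shift simp: hq)
        (simp add: power2_eq_square power4_eq_xxxx)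
    then show "((\<lambda>t. metric_h h (q + t *\<^sub>R axis 1 1) $ 1 $ 1) has_real_derivative - 2 * H * h' / y\<^sup>2) (at 0)"
      by (simp add: metric_h_nth axis_2_nth y_def)
  qed
  have d12: "partial_deriv 2 (\<lambda>q. metric_h h q $ 1 $ 1) q = - 2 * H * (2 * y\<^sup>2 - H) / y ^ 3"
    unfolding partial_deriv_def
  proof (rule DERIV_imp_deriv)
    have "((\<lambda>t. - ((h (q $ 1) + (y + t)\<^sup>2)\<^sup>2) / (y + t)\<^sup>2) has_real_derivative
        - 2 * H * (2 * y\<^sup>2 - H) / y ^ 3) (at 0)"
      using y by (auto intro!: derivative_eq_intros simp: hq)
        (simp add: field_simps power2_eq_square power3_eq_cube power4_eq_xxxx)
    then show "((\<lambda>t. metric_h h (q + t *\<^sub>R axis 2 1) $ 1 $ 1) has_real_derivative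
        - 2 * H * (2 * y\<^sup>2 - H) / y ^ 3) (at 0)"
      by (simp add: metric_h_nth axis_2_nth y_def)
  qed
  have d21: "partial_deriv 1 (\<lambda>q. metric_h h q $ 2 $ 2) q = 0"
    by (simp add: partial_deriv_def metric_h_nth axis_2_nth)
  have d22: "partial_deriv 2 (\<lambda>q. metric_h h q $ 2 $ 2) q = - 2 / y ^ 3"
    unfolding partial_deriv_def
  proof (rule DERIV_imp_deriv)
    have "((\<lambda>t. 1 / (y + t)\<^sup>2) has_real_derivative - 2 / y ^ 3) (at 0)"
      using y by (auto intro!: derivative_eq_intros)
        (simp add: field_simps power2_eq_square power3_eq_cube power4_eq_xxxx)
    then show "((\<lambda>t. metric_h h (q + t *\<^sub>R axis 2 1) $ 2 $ 2) has_real_derivative - 2 / y ^ 3) (at 0)"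
      by (simp add: metric_h_nth axis_2_nth y_def)
  qed
  have d0: "partial_deriv i (\<lambda>q. metric_h h q $ 1 $ 2) q = 0" "partial_deriv i (\<lambda>q. metric_h h q $ 2 $ 1) q = 0" for i
    by (simp_all add: partial_deriv_def metric_h_nth)
  note simps = christoffel_def sum_2 inv vector_2 d0 d11 d12 d21 d22
  show "christoffel (metric_h h) 1 1 1 q = h' / H"
    "christoffel (metric_h h) 1 1 2 q = (2 * y\<^sup>2 - H) / (y * H)"
    "christoffel (metric_h h) 1 2 1 q = (2 * y\<^sup>2 - H) / (y * H)"
    "christoffel (metric_h h) 1 2 2 q = 0"
    "christoffel (metric_h h) 2 1 1 q = H * (2 * y\<^sup>2 - H) / y"
    "christoffel (metric_h h) 2 1 2 q = 0"
    "christoffel (metric_h h) 2 2 1 q = 0"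
    "christoffel (metric_h h) 2 2 2 q = - 1 / y"
    using y H by (simp_all add: simps) (simp_all add: divide_simps power2_eq_square power3_eq_cube)
qed

lemma geodesic_equation_metric_h:
  fixes q v w :: "real ^ 2"
  assumes "q \<in> H0 h" and "(h has_real_derivative h') (at (q $ 1))"
  defines "H \<equiv> h (q $ 1) + (q $ 2)\<^sup>2" and "y \<equiv> q $ 2"
  shows "(\<forall>k. w $ k + (\<Sum>i\<in>UNIV. \<Sum>j\<in>UNIV. christoffel (metric_h h) k i j q * v $ i * v $ j) = 0) \<longleftrightarrow>
    w $ 1 = - (h' / H * (v $ 1)\<^sup>2 + 2 * ((2 * y\<^sup>2 - H) / (y * H)) * v $ 1 * v $ 2) \<and>
    w $ 2 = (v $ 2)\<^sup>2 / y - H * (2 * y\<^sup>2 - H) / y * (v $ 1)\<^sup>2"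
  unfolding forall_2 sum_2 christoffel_metric_h[OF assms(1,2)]
  unfolding H_def[symmetric] unfolding y_def[symmetric]
  by (simp add: power2_eq_square eq_diff_eq eq_neg_iff_add_eq_0 algebra_simps)

lemma has_vector_derivative_vector_2:
  assumes "(x has_real_derivative x') (at s)" "(y has_real_derivative y') (at s)"
  shows "((\<lambda>s. vector [x s, y s] :: real ^ 2) has_vector_derivative vector [x', y']) (at s)"
proof -
  have *: "vector [a, b] = a *\<^sub>R axis 1 1 + b *\<^sub>R (axis 2 1 :: real ^ 2)" for a b
    by (simp add: vec_eq_iff forall_2 vector_2 axis_2_nth)
  show ?thesis
    unfolding * by (intro has_vector_derivative_add has_vector_derivative_scaleR_const assms)
qed

section \<open>Eliminating and restoring the affine parameter\<close>

context admissible_curve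
begin

text \<open>On the graph of \<open>\<Psi>\<close> the first geodesic equation reads \<open>x'' = - G(x) x'\<^sup>2\<close>.\<close>

definition G :: "real \<Rightarrow> real" where
  "G x = deriv h x / H x + 2 * ((2 * (\<Psi> x)\<^sup>2 - H x) / (\<Psi> x * H x)) * p x"

text \<open>This grouping is what elimination of the parameter produces: \<open>G x * p x\<close>
  comes from the first geodesic equation, the remaining terms from the second.\<close>

lemma explicit_geodesic_equation_alt:
  "explicit_geodesic_equation h I \<Psi> \<longleftrightarrow>
     (\<forall>x\<in>I. deriv p x = G x * p x + (p x)\<^sup>2 / \<Psi> x - H x * (2 * (\<Psi> x)\<^sup>2 - H x) / \<Psi> x)"
  unfolding explicit_geodesic_equation_def
proof (rule ball_cong[OF refl])
  fix x assume x: "x \<in> I"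
  have \<Psi>: "(\<Psi> x)\<^sup>2 + h x = H x" "3 * (\<Psi> x)\<^sup>2 - h x = 4 * (\<Psi> x)\<^sup>2 - H x"
    "(\<Psi> x) ^ 4 - (h x)\<^sup>2 = H x * (2 * (\<Psi> x)\<^sup>2 - H x)"
    by (simp_all add: H_def power2_eq_square power4_eq_xxxx algebra_simps)
  have "(4 * (\<Psi> x)\<^sup>2 - H x) / H x * ((p x)\<^sup>2 / \<Psi> x) + deriv h x * p x / H x =
      G x * p x + (p x)\<^sup>2 / \<Psi> x"
    using \<Psi>_pos[OF x] H_nz[OF x]
    by (simp add: G_def add_divide_distrib diff_divide_distrib power2_eq_square algebra_simps)
  then show "deriv p x = (3 * (\<Psi> x)\<^sup>2 - h x) / ((\<Psi> x)\<^sup>2 + h x) * ((p x)\<^sup>2 / \<Psi> x)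
        + deriv h x * p x / ((\<Psi> x)\<^sup>2 + h x) - ((\<Psi> x) ^ 4 - (h x)\<^sup>2) / \<Psi> x \<longleftrightarrow>
      deriv p x = G x * p x + (p x)\<^sup>2 / \<Psi> x - H x * (2 * (\<Psi> x)\<^sup>2 - H x) / \<Psi> x"
    unfolding \<Psi> by simp
qed

lemma cont_G: "continuous_on I G"
  unfolding G_def[abs_def] using H_nz \<Psi>_pos
  by (intro continuous_intros cont_H cont_\<Psi> cont_p cont_deriv_h) force+

text \<open>Differentiating \<open>y = \<Psi>(x)\<close> twice along the curve gives
  \<open>y'' = \<Psi>'' x'\<^sup>2 + \<Psi>' x''\<close>. Both geodesic equations are then inserted,
  and \<open>x'\<^sup>2\<close>, nonzero by assumption, is cancelled.\<close>

lemma explicit_geodesic_imp_equation: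
  assumes "explicit_geodesic h x0 I \<Psi>"
  shows "explicit_geodesic_equation h I \<Psi>"
  unfolding explicit_geodesic_equation_alt
proof
  fix x assume x: "x \<in> I"
  obtain J \<gamma> where J: "open J" and geo: "geodesic_on (H0 h) (metric_h h) J \<gamma>"
    and nz: "\<forall>s\<in>J. vector_derivative \<gamma> (at s) $ 1 \<noteq> 0"
    and img: "(\<lambda>s. \<gamma> s $ 1) ` J = I" and graph0: "\<forall>s\<in>J. \<gamma> s $ 2 = \<Psi> (\<gamma> s $ 1)"
    using assms unfolding explicit_geodesic_def by (elim exE conjE)
  note graph = bspec[OF graph0]
  obtain \<gamma>' \<gamma>'' where "\<forall>s\<in>J. (\<gamma> has_vector_derivative \<gamma>' s) (at s) \<and>
      (\<gamma>' has_vector_derivative \<gamma>'' s) (at s) \<and>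
      (\<forall>k. \<gamma>'' s $ k
        + (\<Sum>i\<in>UNIV. \<Sum>j\<in>UNIV. christoffel (metric_h h) k i j (\<gamma> s) * \<gamma>' s $ i * \<gamma>' s $ j) = 0)"
    using geo unfolding geodesic_on_def by (elim exE conjE)
  then have d: "\<And>s. s \<in> J \<Longrightarrow> (\<gamma> has_vector_derivative \<gamma>' s) (at s)"
    "\<And>s. s \<in> J \<Longrightarrow> (\<gamma>' has_vector_derivative \<gamma>'' s) (at s)"
    "\<And>s. s \<in> J \<Longrightarrow> \<forall>k. \<gamma>'' s $ k
       + (\<Sum>i\<in>UNIV. \<Sum>j\<in>UNIV. christoffel (metric_h h) k i j (\<gamma> s) * \<gamma>' s $ i * \<gamma>' s $ j) = 0"
    by simp_all
  have mem: "\<gamma> s \<in> H0 h" if "s \<in> J" for s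
    using geo that unfolding geodesic_on_def by blast
  have d1: "((\<lambda>s. \<gamma> s $ k) has_real_derivative \<gamma>' s $ k) (at s)"
    and d2: "((\<lambda>s. \<gamma>' s $ k) has_real_derivative \<gamma>'' s $ k) (at s)" if "s \<in> J" for s k
    using bounded_linear.has_vector_derivative[OF bounded_linear_vec_nth d(1)[OF that]]
      bounded_linear.has_vector_derivative[OF bounded_linear_vec_nth d(2)[OF that]]
    by (simp_all add: has_real_derivative_iff_has_vector_derivative)
  have xI: "\<gamma> s $ 1 \<in> I" if "s \<in> J" for s using img that by blast
  have v2: "\<gamma>' s $ 2 = p (\<gamma> s $ 1) * \<gamma>' s $ 1" if s: "s \<in> J" for s
  proof -
    have "((\<lambda>s. \<Psi> (\<gamma> s $ 1)) has_real_derivative p (\<gamma> s $ 1) * \<gamma>' s $ 1) (at s)"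
      by (rule DERIV_chain2[OF der_\<Psi>[OF xI[OF s]] d1[OF s]])
    then have "((\<lambda>s. \<gamma> s $ 2) has_real_derivative p (\<gamma> s $ 1) * \<gamma>' s $ 1) (at s)"
      by (rule has_field_derivative_transform_within_open[OF _ J s]) (simp add: graph)
    then show ?thesis using d1[OF s] DERIV_unique by blast
  qed
  have "x \<in> (\<lambda>s. \<gamma> s $ 1) ` J" using img x by simp
  then obtain s where s: "s \<in> J" "\<gamma> s $ 1 = x" by (elim imageE) simp
  have "((\<lambda>s. p (\<gamma> s $ 1) * \<gamma>' s $ 1) has_real_derivative
      deriv p x * \<gamma>' s $ 1 * \<gamma>' s $ 1 + \<gamma>'' s $ 1 * p x) (at s)"
    using DERIV_mult[OF DERIV_chain2[OF der_p[OF xI[OF s(1)]] d1[OF s(1)]] d2[OF s(1)]] s(2) by simp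
  then have "((\<lambda>s. \<gamma>' s $ 2) has_real_derivative
      deriv p x * \<gamma>' s $ 1 * \<gamma>' s $ 1 + \<gamma>'' s $ 1 * p x) (at s)"
    by (rule has_field_derivative_transform_within_open[OF _ J s(1)]) (simp add: v2)
  then have w2: "\<gamma>'' s $ 2 = deriv p x * \<gamma>' s $ 1 * \<gamma>' s $ 1 + \<gamma>'' s $ 1 * p x"
    using d2[OF s(1)] DERIV_unique by blast
  define c where "c = \<gamma>' s $ 1"
  have c: "c \<noteq> 0"
    using bspec[OF nz s(1)] vector_derivative_at[OF d(1)[OF s(1)]] by (simp add: c_def)
  have Hx: "h x + (\<Psi> x)\<^sup>2 = H x" by (simp add: H_def)
  from d(3)[OF s(1)] have
    e1: "\<gamma>'' s $ 1 = - (deriv h x / H x * c\<^sup>2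
       + 2 * ((2 * (\<Psi> x)\<^sup>2 - H x) / (\<Psi> x * H x)) * c * (p x * c))" and
    e2: "\<gamma>'' s $ 2 = (p x * c)\<^sup>2 / \<Psi> x - H x * (2 * (\<Psi> x)\<^sup>2 - H x) / \<Psi> x * c\<^sup>2"
    unfolding geodesic_equation_metric_h[OF mem[OF s(1)] der_h]
    by (simp_all add: s(2) graph[OF s(1)] v2[OF s(1)] c_def[symmetric] Hx)
  have "\<gamma>'' s $ 1 = - G x * c\<^sup>2"
    unfolding e1 G_def by (simp add: algebra_simps power2_eq_square)
  then have "deriv p x * c\<^sup>2 = \<gamma>'' s $ 2 + G x * p x * c\<^sup>2"
    using w2 by (simp add: c_def power2_eq_square algebra_simps)
  also have "\<dots> = (G x * p x + (p x)\<^sup>2 / \<Psi> x - H x * (2 * (\<Psi> x)\<^sup>2 - H x) / \<Psi> x) * c\<^sup>2"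
    unfolding e2 by (simp add: algebra_simps power_mult_distrib)
  finally show "deriv p x = G x * p x + (p x)\<^sup>2 / \<Psi> x - H x * (2 * (\<Psi> x)\<^sup>2 - H x) / \<Psi> x"
    using c by simp
qed

text \<open>An affine parameter is \<open>s = \<integral> W dx\<close> with \<open>W' = G W\<close>.\<close>

lemma equation_imp_explicit_geodesic:
  assumes eq: "explicit_geodesic_equation h I \<Psi>"
  shows "explicit_geodesic h x0 I \<Psi>"
proof -
  define W where "W x = exp (LBINT t=ereal x0..ereal x. G t)" for x
  have W_pos: "W x > 0" for x by (simp add: W_def)
  have W: "(W has_real_derivative G x * W x) (at x)" if "x \<in> I" for x
    using interval_integral_has_vector_derivative[OF cont_G x0 that]
    unfolding W_def[abs_def] has_real_derivative_iff_has_vector_derivative[symmetric]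
    by (auto intro!: derivative_eq_intros)
  then have cont_W: "continuous_on I W"
    by (meson DERIV_isCont continuous_at_imp_continuous_on)
  \<comment> \<open>As \<open>W > 0\<close>, \<open>S\<close> is strictly increasing and its inverse
    \<open>X\<close> recovers the abscissa from the parameter. Integrating from \<open>x0\<close>
    assigns the parameter 0 to \<open>x0\<close>.\<close>
  define S where "S x = (LBINT t=ereal x0..ereal x. W t)" for x
  have S: "(S has_real_derivative W x) (at x)" if "x \<in> I" for x
    using interval_integral_has_vector_derivative[OF cont_W x0 that]
    by (simp add: S_def[abs_def] has_real_derivative_iff_has_vector_derivative)
  then have cont_S: "continuous_on I S"
    by (meson DERIV_isCont continuous_at_imp_continuous_on)
  have mono: "S x < S y" if "x \<in> I" "y \<in> I" "x < y" for x y
  proof (rule DERIV_pos_imp_increasing[OF that(3)])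
    fix z assume "x \<le> z" "z \<le> y"
    then have "z \<in> I" using is_interval_einterval that unfolding is_interval_1 by blast
    then show "\<exists>d. (S has_real_derivative d) (at z) \<and> d > 0" using S W_pos by blast
  qed
  then have inj: "inj_on S I" by (metis inj_onI less_irrefl linorder_neqE)
  define J where "J = S ` I"
  define X where "X = inv_into I S"
  have XS: "X (S x) = x" if "x \<in> I" for x
    using inj that by (simp add: X_def inv_into_f_f)
  have XI: "X s \<in> I" and SX: "S (X s) = s" if "s \<in> J" for s
    using that by (auto simp: J_def XS)
  have openJ: "open J"
    unfolding J_def by (rule invariance_of_domain[OF cont_S open_einterval inj])
  have intJ: "is_interval J"
    unfolding J_def using cont_S is_interval_einterval
    by (simp add: is_interval_connected_1 connected_continuous_image)
  have J0: "0 \<in> J" and X0: "X 0 = x0"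
    using x0 XS[OF x0] by (auto simp: J_def S_def intro!: image_eqI[of _ _ x0])
  have X: "(X has_real_derivative 1 / W (X s)) (at s)" if "s \<in> J" for s
    unfolding has_field_derivative_def
    by (rule has_derivative_inverse_strong_x[OF open_einterval XI[OF that] cont_S XS
          S[OF XI[OF that], unfolded has_field_derivative_def] _ SX[OF that]])
      (use W_pos[of "X s"] in \<open>auto simp: fun_eq_iff\<close>)
  define \<gamma> where "\<gamma> s = (vector [X s, \<Psi> (X s)] :: real ^ 2)" for s
  define \<gamma>' where "\<gamma>' s = (vector [1 / W (X s), p (X s) * (1 / W (X s))] :: real ^ 2)" for s
  define \<gamma>'' where "\<gamma>'' s = (vector [- G (X s) * (1 / W (X s))\<^sup>2,
      deriv p (X s) * (1 / W (X s)) * (1 / W (X s)) + - G (X s) * (1 / W (X s))\<^sup>2 * p (X s)] :: real ^ 2)" for s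
  have der1: "(\<gamma> has_vector_derivative \<gamma>' s) (at s)" if "s \<in> J" for s
    unfolding \<gamma>_def[abs_def] \<gamma>'_def
    by (intro has_vector_derivative_vector_2 X that der_\<Psi> XI
        DERIV_chain2[where f = \<Psi> and g = X])
  have der2: "(\<gamma>' has_vector_derivative \<gamma>'' s) (at s)" if s: "s \<in> J" for s
  proof -
    have "((\<lambda>s. 1 / W (X s)) has_real_derivative - G (X s) * (1 / W (X s))\<^sup>2) (at s)"
      using W_pos[of "X s"]
      by (auto intro!: derivative_eq_intros DERIV_chain2[where f = W and g = X] W XI X s
          simp: power2_eq_square)
    then show ?thesis
      unfolding \<gamma>'_def[abs_def] \<gamma>''_def
      by (intro has_vector_derivative_vector_2 DERIV_mult der_p XI X s
          DERIV_chain2[where f = p and g = X])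
  qed
  have mem: "\<gamma> s \<in> H0 h" if "s \<in> J" for s
    using \<Psi>_pos[OF XI[OF that]] H_nz[OF XI[OF that]]
    by (auto simp: H0_def \<gamma>_def vector_2 H_def)
  have geo: "\<forall>k. \<gamma>'' s $ k
      + (\<Sum>i\<in>UNIV. \<Sum>j\<in>UNIV. christoffel (metric_h h) k i j (\<gamma> s) * \<gamma>' s $ i * \<gamma>' s $ j) = 0"
    if s: "s \<in> J" for s
  proof -
    define x c where "x = X s" and "c = 1 / W x"
    have x: "x \<in> I" using XI[OF s] by (simp add: x_def)
    have Hx: "h x + (\<Psi> x)\<^sup>2 = H x" by (simp add: H_def)
    have p': "deriv p x = G x * p x + (p x)\<^sup>2 / \<Psi> x - H x * (2 * (\<Psi> x)\<^sup>2 - H x) / \<Psi> x"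
      using eq x unfolding explicit_geodesic_equation_alt by blast
    have "- G x * c\<^sup>2 = - (deriv h x / H x * c\<^sup>2
        + 2 * ((2 * (\<Psi> x)\<^sup>2 - H x) / (\<Psi> x * H x)) * c * (p x * c))"
      unfolding G_def by (simp add: algebra_simps power2_eq_square)
    moreover have "deriv p x * c * c + - G x * c\<^sup>2 * p x =
        (p x * c)\<^sup>2 / \<Psi> x - H x * (2 * (\<Psi> x)\<^sup>2 - H x) / \<Psi> x * c\<^sup>2"
      unfolding p' by (simp add: algebra_simps power2_eq_square)
    ultimately show ?thesis
      unfolding geodesic_equation_metric_h[OF mem[OF s] der_h]
      unfolding \<gamma>_def \<gamma>'_def \<gamma>''_def vector_2 x_def[symmetric] c_def[symmetric] Hx by blast
  qed
  have "geodesic_on (H0 h) (metric_h h) J \<gamma>"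
    unfolding geodesic_on_def using mem der1 der2 geo by blast
  moreover have "vector_derivative \<gamma> (at s) $ 1 \<noteq> 0" if "s \<in> J" for s
    using W_pos[of "X s"] by (simp add: vector_derivative_at[OF der1[OF that]] \<gamma>'_def vector_2)
  moreover have "(\<lambda>s. \<gamma> s $ 1) ` J = I"
    by (auto simp: \<gamma>_def vector_2 J_def XS image_image)
  ultimately show ?thesis
    unfolding explicit_geodesic_def
    by (intro exI[of _ J] exI[of _ \<gamma>] conjI openJ intJ J0) (auto simp: \<gamma>_def vector_2 X0)
qed

end

text \<open>For a fundamental system with \<open>u\<^sub>1 = 1, u\<^sub>1' = 0\<close> and \<open>u\<^sub>2 = 0, u\<^sub>2' = 1\<close> at \<open>x0\<close>, the function
  \<open>\<Psi>\<^sup>2 = (u\<^sub>1'\<^sup>2 + k\<^sup>2 u\<^sub>2'\<^sup>2) / (u\<^sub>1\<^sup>2 + k\<^sup>2 u\<^sub>2\<^sup>2)\<close> is a solution with \<open>\<Psi> x0 = k\<close> and \<open>\<Psi>' x0 = 0\<close>;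
  it is \<open>\<bar>u' / u\<bar>\<^sup>2\<close> for the complex solution \<open>u = u\<^sub>1 + \<i> k u\<^sub>2\<close>.\<close>

lemma explicit_geodesic_equation_local_existence:
  assumes h: "h C1_differentiable_on UNIV"
  obtains a b :: real and \<Psi> where "a < x0" "x0 < b" "admissible h {a<..<b} \<Psi>"
    "explicit_geodesic_equation h {a<..<b} \<Psi>"
proof -
  have der_h: "(h has_real_derivative deriv h x) (at x)" for x
    using C1_differentiable_on_real_deriv(1)[OF h] by simp
  have cont_h: "continuous_on S h" and cont_h': "continuous_on S (deriv h)" for S
    using der_h C1_differentiable_on_real_deriv(2)[OF h]
    by (auto intro: DERIV_continuous_on continuous_on_subset has_field_derivative_at_within)
  obtain \<delta> where \<delta>: "\<delta> > 0"
    and ex: "\<And>\<alpha> \<beta>. \<exists>u v. u x0 = \<alpha> \<and> v x0 = \<beta> \<and>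
       (\<forall>x\<in>{x0-\<delta><..<x0+\<delta>}. (u has_real_derivative v x) (at x) \<and>
          (v has_real_derivative - h x * u x) (at x))"
    using linear_ode2_local_existence[OF cont_h, of x0] by metis
  define J where "J = {x0-\<delta><..<x0+\<delta>}"
  obtain u1 v1 where u1: "u1 x0 = 1" "v1 x0 = 0"
    and d1: "\<And>x. x \<in> J \<Longrightarrow> (u1 has_real_derivative v1 x) (at x)"
      "\<And>x. x \<in> J \<Longrightarrow> (v1 has_real_derivative - h x * u1 x) (at x)"
    using ex[of 1 0] unfolding J_def by blast
  obtain u2 v2 where u2: "u2 x0 = 0" "v2 x0 = 1"
    and d2: "\<And>x. x \<in> J \<Longrightarrow> (u2 has_real_derivative v2 x) (at x)"
      "\<And>x. x \<in> J \<Longrightarrow> (v2 has_real_derivative - h x * u2 x) (at x)"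
    using ex[of 0 1] unfolding J_def by blast
  have x0J: "x0 \<in> J" "open J" using \<delta> by (simp_all add: J_def)
  \<comment> \<open>\<open>\<Psi> x0\<close> will be \<open>k\<close>, so
    \<open>k\<^sup>2 + h x0\<close> must not vanish: 1 serves unless \<open>h x0 = - 1\<close>, and
    then 2 gives 3.\<close>
  define k :: real where "k = (if h x0 = - 1 then 2 else 1)"
  have k: "k\<^sup>2 + h x0 \<noteq> 0" "k > 0" by (auto simp: k_def)
  \<comment> \<open>For \<open>u = u1 + \<i> k u2\<close>, these are
    \<open>\<bar>u\<bar>\<^sup>2\<close>, \<open>\<bar>u'\<bar>\<^sup>2\<close> and the real part of
    \<open>u'\<close> times the conjugate of \<open>u\<close>; \<open>N / L\<close> will be
    \<open>h + \<Psi>\<^sup>2\<close>.\<close>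
  define L where "L x = u1 x * u1 x + k\<^sup>2 * (u2 x * u2 x)" for x
  define M where "M x = v1 x * v1 x + k\<^sup>2 * (v2 x * v2 x)" for x
  define K where "K x = u1 x * v1 x + k\<^sup>2 * (u2 x * v2 x)" for x
  define N where "N x = M x + h x * L x" for x
  have L: "(L has_real_derivative 2 * K x) (at x)" if "x \<in> J" for x
    unfolding L_def[abs_def] K_def
    by (rule DERIV_cong[OF DERIV_add[OF DERIV_mult[OF d1(1) d1(1)] DERIV_cmult[OF DERIV_mult[OF d2(1) d2(1)]]]])
      (use that in \<open>auto simp: algebra_simps\<close>)
  have M: "(M has_real_derivative - 2 * h x * K x) (at x)" if "x \<in> J" for x
    unfolding M_def[abs_def] K_def
    by (rule DERIV_cong[OF DERIV_add[OF DERIV_mult[OF d1(2) d1(2)] DERIV_cmult[OF DERIV_mult[OF d2(2) d2(2)]]]])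
      (use that in \<open>auto simp: algebra_simps\<close>)
  have K: "(K has_real_derivative M x - h x * L x) (at x)" if "x \<in> J" for x
    unfolding K_def[abs_def] M_def L_def
    by (rule DERIV_cong[OF DERIV_add[OF DERIV_mult[OF d1(1) d1(2)] DERIV_cmult[OF DERIV_mult[OF d2(1) d2(2)]]]])
      (use that in \<open>auto simp: algebra_simps\<close>)
  have N: "(N has_real_derivative deriv h x * L x) (at x)" if "x \<in> J" for x
    unfolding N_def[abs_def]
    by (rule DERIV_cong[OF DERIV_add[OF M[OF that] DERIV_mult[OF der_h L[OF that]]]])
      (simp add: algebra_simps)
  have cont: "continuous_on J L" "continuous_on J M" "continuous_on J K" "continuous_on J N"
    by (meson L M K N DERIV_isCont continuous_at_imp_continuous_on)+
  \<comment> \<open>One open condition for \<open>L > 0\<close>, \<open>M > 0\<close> and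
    \<open>N \<noteq> 0\<close>; the square encodes the last.\<close>
  define T where "T = J \<inter> (\<lambda>x. min (L x) (min (M x) ((N x)\<^sup>2))) -` {0<..}"
  have "open T"
    unfolding T_def using cont x0J
    by (intro continuous_open_preimage continuous_intros) auto
  moreover have at_x0: "L x0 = 1" "M x0 = k\<^sup>2" "K x0 = 0"
    by (simp_all add: L_def M_def K_def u1 u2)
  then have "x0 \<in> T"
    using x0J k by (auto simp: T_def N_def)
  ultimately obtain \<epsilon> where \<epsilon>: "\<epsilon> > 0" "ball x0 \<epsilon> \<subseteq> T"
    using open_contains_ball by blast
  define I where "I = {x0-\<epsilon><..<x0+\<epsilon>}"
  have "I \<subseteq> T" using \<epsilon>(2) by (simp add: I_def ball_eq_greaterThanLessThan)
  then have pos: "x \<in> J" "L x > 0" "M x > 0" "N x \<noteq> 0" if "x \<in> I" for x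
    using that by (auto simp: T_def)
  have openI: "open I" and x0I: "x0 \<in> I" using \<epsilon> by (auto simp: I_def)
  have contI: "continuous_on I L" "continuous_on I M" "continuous_on I K" "continuous_on I N"
    using cont pos(1) by (auto intro: continuous_on_subset)
  define \<Psi> where "\<Psi> x = sqrt (M x / L x)" for x
  have \<Psi>_pos: "\<Psi> x > 0" and \<Psi>_square: "(\<Psi> x)\<^sup>2 = M x / L x" if "x \<in> I" for x
    using pos[OF that] by (simp_all add: \<Psi>_def)
  define P where "P x = - (K x * N x) / ((L x)\<^sup>2 * \<Psi> x)" for x
  have der_\<Psi>: "(\<Psi> has_real_derivative P x) (at x)" if x: "x \<in> I" for x
  proof -
    have "((\<lambda>x. M x / L x) has_real_derivative - 2 * K x * N x / (L x)\<^sup>2) (at x)"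
      by (rule DERIV_cong[OF DERIV_divide[OF M L]])
        (use pos[OF x] in \<open>auto simp: N_def field_simps power2_eq_square\<close>)
    from DERIV_chain2[OF DERIV_real_sqrt this] show ?thesis
      using pos[OF x] unfolding \<Psi>_def[abs_def] P_def
      by (auto elim!: DERIV_cong simp: field_simps)
  qed
  have cont_\<Psi>: "continuous_on I \<Psi>"
    by (meson der_\<Psi> DERIV_isCont continuous_at_imp_continuous_on)
  have cont_P: "continuous_on I P"
    unfolding P_def[abs_def] using pos \<Psi>_pos
    by (intro continuous_intros contI cont_\<Psi>) force
  have deriv_\<Psi>: "deriv \<Psi> x = P x" if "x \<in> I" for x
    by (rule DERIV_imp_deriv[OF der_\<Psi>[OF that]])
  \<comment> \<open>The quotient rule for \<open>P\<close>, written out so that continuity of the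
    second derivative of \<open>\<Psi>\<close> can be read off.\<close>
  define P' where "P' x = (- ((M x - h x * L x) * N x + deriv h x * L x * K x) * ((L x)\<^sup>2 * \<Psi> x)
     - - (K x * N x) * (2 * L x * (2 * K x) * \<Psi> x + P x * (L x)\<^sup>2))
     / (((L x)\<^sup>2 * \<Psi> x) * ((L x)\<^sup>2 * \<Psi> x))" for x
  have der_P: "(deriv \<Psi> has_real_derivative P' x) (at x)" if x: "x \<in> I" for x
  proof -
    have "((\<lambda>x. (L x)\<^sup>2) has_real_derivative 2 * L x * (2 * K x)) (at x)"
      by (rule DERIV_cong[OF DERIV_power[OF L[OF pos(1)[OF x]]]]) simp
    then have "((\<lambda>x. - (K x * N x) / ((L x)\<^sup>2 * \<Psi> x)) has_real_derivative P' x) (at x)"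
      unfolding P'_def
      by (intro DERIV_divide DERIV_minus DERIV_mult K N der_\<Psi> pos x)
        (use pos[OF x] \<Psi>_pos[OF x] in auto)
    then show ?thesis
      by (rule has_field_derivative_transform_within_open[OF _ openI x]) (simp add: deriv_\<Psi> P_def)
  qed
  have cont_P': "continuous_on I P'"
    unfolding P'_def[abs_def] using pos \<Psi>_pos
    by (intro continuous_intros contI cont_\<Psi> cont_P cont_h cont_h') force
  have H: "h x + (\<Psi> x)\<^sup>2 = N x / L x" if "x \<in> I" for x
    using pos[OF that] by (simp add: \<Psi>_square[OF that] N_def field_simps)
  have "admissible h I \<Psi>"
    unfolding admissible_def C2_differentiable_on_def C1_differentiable_on_def
      has_real_derivative_iff_has_vector_derivative[symmetric]
  proof (intro conjI)
    show "\<exists>D. (\<forall>x\<in>I. (\<Psi> has_real_derivative D x) (at x)) \<and> continuous_on I D"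
      using der_\<Psi> cont_P by blast
    show "\<exists>D. (\<forall>x\<in>I. (deriv \<Psi> has_real_derivative D x) (at x)) \<and> continuous_on I D"
      using der_P cont_P' by blast
    show "\<forall>x\<in>I. \<Psi> x > 0" using \<Psi>_pos by blast
    show "\<forall>x\<in>I. h x \<noteq> - (\<Psi> x)\<^sup>2"
      using H pos by (metis add.left_inverse divide_eq_0_iff less_irrefl)
    \<comment> \<open>Since \<open>h + \<Psi>\<^sup>2\<close> is nonzero at \<open>x0\<close>, this
      single point refutes both forbidden identities.\<close>
    have "deriv \<Psi> x0 = 0" by (simp add: deriv_\<Psi>[OF x0I] P_def at_x0)
    then show "\<exists>x\<in>I. h x + (\<Psi> x)\<^sup>2 \<noteq> deriv \<Psi> x" "\<exists>x\<in>I. h x + (\<Psi> x)\<^sup>2 \<noteq> - deriv \<Psi> x"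
      using H[OF x0I] pos[OF x0I] x0I by (auto intro!: bexI[of _ x0])
  qed
  then have adm: "admissible h {x0-\<epsilon><..<x0+\<epsilon>} \<Psi>" by (simp add: I_def)
  interpret curve: admissible_curve h \<Psi> "ereal (x0 - \<epsilon>)" "ereal (x0 + \<epsilon>)" x0
    using h adm \<epsilon>(1) by unfold_locales simp_all
  have "explicit_geodesic_equation h I \<Psi>"
  proof -
    have "(curve.Z has_real_derivative 2 * (curve.Z x)\<^sup>2 - (\<Psi> x)\<^sup>2 + h x) (at x)" if x: "x \<in> I" for x
    proof -
      \<comment> \<open>\<open>Z\<close> is minus the real part of \<open>u' / u\<close>, hence
        differentiable by the formulas for \<open>K\<close> and \<open>L\<close>.\<close>
      have Z: "curve.Z y = - (K y / L y)" if "y \<in> I" for y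
        using pos[OF that] \<Psi>_pos[OF that] H[OF that]
        by (simp add: curve.Z_def curve.H_def deriv_\<Psi>[OF that] P_def power2_eq_square)
      have "((\<lambda>x. - (K x / L x)) has_real_derivative 2 * (curve.Z x)\<^sup>2 - (\<Psi> x)\<^sup>2 + h x) (at x)"
        unfolding Z[OF x] \<Psi>_square[OF x]
        by (rule DERIV_cong[OF DERIV_minus[OF DERIV_divide[OF K L]]])
          (use pos[OF x] in \<open>auto simp: field_simps power2_eq_square\<close>)
      then show ?thesis
        by (rule has_field_derivative_transform_within_open[OF _ openI x]) (simp add: Z)
    qed
    then show ?thesis using curve.explicit_geodesic_equation_iff by (simp add: I_def)
  qed
  with adm \<epsilon>(1) show thesis by (intro that[of "x0-\<epsilon>" "x0+\<epsilon>"]) (simp_all add: I_def)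
qed

section \<open>Local isometry with anti-de Sitter space\<close>

lemma ads_form_bilinear:
  "ads_form (v + w) z = ads_form v z + ads_form w z"
  "ads_form z (v + w) = ads_form z v + ads_form z w"
  "ads_form (v - w) z = ads_form v z - ads_form w z"
  "ads_form z (v - w) = ads_form z v - ads_form z w"
  "ads_form (r *\<^sub>R v) z = r * ads_form v z"
  "ads_form z (r *\<^sub>R v) = r * ads_form z v"
  by (simp_all add: ads_form_def algebra_simps)

lemma bounded_linear_ads_form_left: "bounded_linear (\<lambda>v. ads_form v w)"
  by (simp add: linear_conv_bounded_linear[symmetric] linear_iff ads_form_bilinear)

text \<open>The cone over the image is open by invariance of domain, and a positive multiple \<open>t X\<close> of
  a point of the quadric determines \<open>t\<close> through \<open>ads_form (t X) (t X) = - t\<^sup>2\<close>.\<close>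

lemma openin_AdS2_image:
  fixes \<phi> :: "real ^ 2 \<Rightarrow> real ^ 3"
  assumes "open U" "continuous_on U \<phi>" "inj_on \<phi> U" "\<phi> ` U \<subseteq> AdS2"
  shows "openin (top_of_set AdS2) (\<phi> ` U)"
proof -
  define F where "F = (\<lambda>(q, t::real). t *\<^sub>R \<phi> q)"
  define T where "T = F ` (U \<times> {0<..})"
  have form: "ads_form (F (q, t)) (F (q, t)) = - t\<^sup>2" if "q \<in> U" for q t
    using assms(4) that by (auto simp: F_def ads_form_bilinear AdS2_def power2_eq_square)
  have "open T"
    unfolding T_def
  proof (rule invariance_of_domain_gen)
    show "open (U \<times> {0::real<..})" by (intro open_Times assms) auto
    show "continuous_on (U \<times> {0<..}) F"
      unfolding F_def case_prod_unfold
      by (intro continuous_intros continuous_on_compose2[OF assms(2)]) auto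
    have "q = q' \<and> t = t'"
      if *: "q \<in> U" "q' \<in> U" "t \<in> {0<..}" "t' \<in> {0<..}" "F (q, t) = F (q', t')" for q q' t t'
    proof -
      have "t\<^sup>2 = t'\<^sup>2" using * form[of q t] form[of q' t'] by simp
      then have "t = t'" using *(3,4) by (simp add: power2_eq_iff_nonneg)
      then show "q = q' \<and> t = t'"
        using * inj_onD[OF assms(3)] by (auto simp: F_def)
    qed
    then show "inj_on F (U \<times> {0<..})" by (auto simp: inj_on_def)
    show "DIM(real ^ 3) \<le> DIM((real ^ 2) \<times> real)" by simp
  qed
  moreover have "\<phi> ` U = AdS2 \<inter> T"
  proof
    have "\<phi> ` U \<subseteq> T"
      unfolding T_def F_def by (force intro!: image_eqI[where x = "(_, 1)"])
    then show "\<phi> ` U \<subseteq> AdS2 \<inter> T" using assms(4) by blast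
    show "AdS2 \<inter> T \<subseteq> \<phi> ` U"
    proof
      fix X assume X: "X \<in> AdS2 \<inter> T"
      then obtain q t where q: "q \<in> U" "t > 0" "X = F (q, t)" by (auto simp: T_def)
      then have "t\<^sup>2 = 1" using form[of q t] X by (simp add: AdS2_def)
      then have "t = 1" using q(2) by (simp add: power2_eq_1_iff)
      then show "X \<in> \<phi> ` U" using q by (simp add: F_def)
    qed
  qed
  ultimately show ?thesis by (simp add: openin_open_Int)
qed

text \<open>Under the identification of a vector of \<open>real ^ 3\<close> with a symmetric \<open>2 \<times> 2\<close> matrix for
  which \<open>ads_form X X = det X\<close>, this is the symmetrised product
  \<open>(u w\<^sup>T + w u\<^sup>T) / 2\<close> of the vectors \<open>u = (a, b)\<close> and \<open>w = (c, d)\<close>.\<close>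

definition sym_prod :: "real \<Rightarrow> real \<Rightarrow> real \<Rightarrow> real \<Rightarrow> real ^ 3" where
  "sym_prod a b c d = (a * c) *\<^sub>R vector [1/2, 0, 1/2] + (a * d + b * c) *\<^sub>R vector [0, 1/2, 0]
     + (b * d) *\<^sub>R vector [- (1/2), 0, 1/2]"

text \<open>The polarised determinant of two symmetrised products, expressed through the area forms
  of the factors. For a fundamental system these areas are 0 or the Wronskian up to sign, so the
  frame below has constant inner products.\<close>

lemma ads_form_sym_prod:
  "ads_form (sym_prod a b c d) (sym_prod a' b' c' d') =
     ((a * b' - b * a') * (c * d' - d * c') + (a * d' - b * c') * (c * b' - d * a')) / 4"
  by (simp add: ads_form_def sym_prod_def vector_3 field_simps)

lemma has_vector_derivative_sym_prod:
  assumes "(a has_real_derivative a') (at x)" "(b has_real_derivative b') (at x)"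
    "(c has_real_derivative c') (at x)" "(d has_real_derivative d') (at x)"
  shows "((\<lambda>t. sym_prod (a t) (b t) (c t) (d t)) has_vector_derivative
           sym_prod a' b' (c x) (d x) + sym_prod (a x) (b x) c' d') (at x)"
proof -
  have ac: "((\<lambda>t. a t * c t) has_real_derivative a' * c x + a x * c') (at x)"
    and ad: "((\<lambda>t. a t * d t + b t * c t) has_real_derivative
      (a' * d x + b' * c x) + (a x * d' + b x * c')) (at x)"
    and bd: "((\<lambda>t. b t * d t) has_real_derivative b' * d x + b x * d') (at x)"
    by (auto intro!: derivative_eq_intros assms)
  show ?thesis
    unfolding sym_prod_def
    by (rule has_vector_derivative_eq_rhs[OF has_vector_derivative_add[OF
          has_vector_derivative_add[OF has_vector_derivative_scaleR_const[OF ac]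
            has_vector_derivative_scaleR_const[OF ad]] has_vector_derivative_scaleR_const[OF bd]]])
      (simp add: algebra_simps)
qed

lemma continuous_on_sym_prod:
  assumes "continuous_on S a" "continuous_on S b" "continuous_on S c" "continuous_on S d"
  shows "continuous_on S (\<lambda>t. sym_prod (a t) (b t) (c t) (d t))"
  unfolding sym_prod_def by (intro continuous_intros assms)

lemma open_H0:
  assumes "continuous_on UNIV h"
  shows "open (H0 h)"
proof -
  have "continuous_on UNIV (\<lambda>p::real^2. h (p $ 1))"
    by (intro continuous_on_compose2[OF assms] continuous_intros) auto
  then have "open ({p::real^2. p $ 2 > 0} \<inter> {p. (p $ 2)\<^sup>2 \<noteq> - h (p $ 1)})"
    by (intro open_Int open_Collect_less open_Collect_neq continuous_intros)
  then show ?thesis by (simp add: H0_def Collect_conj_eq)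
qed

lemma metric_h_form:
  "v \<bullet> (metric_h h q *v w) =
     - ((h (q $ 1) + (q $ 2)\<^sup>2)\<^sup>2) / (q $ 2)\<^sup>2 * (v $ 1 * w $ 1) + 1 / (q $ 2)\<^sup>2 * (v $ 2 * w $ 2)"
  by (simp add: metric_h_def inner_vec_def matrix_vector_mult_def sum_2 vector_2)

text \<open>A fundamental system \<open>(u\<^sub>1, u\<^sub>2)\<close> of \<open>u'' + h u = 0\<close> with Wronskian 1 gives the isometry
  \<open>(x, \<Psi>) \<mapsto> \<Psi> u u\<^sup>T - \<Psi>\<^sup>-\<^sup>1 u' u'\<^sup>T\<close>; since \<open>(u' u'\<^sup>T)' = - h (u u\<^sup>T)'\<close>, its partial
  derivatives involve no derivative of \<open>h\<close>.\<close>

lemma locally_AdS2_metric_h: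
  assumes h: "continuous_on UNIV h"
  shows "locally_AdS2 (H0 h) (metric_h h)"
  unfolding locally_AdS2_def
proof
  fix p assume p: "p \<in> H0 h"
  obtain \<delta> where \<delta>: "\<delta> > 0"
    and ex: "\<And>\<alpha> \<beta>. \<exists>u v. u (p $ 1) = \<alpha> \<and> v (p $ 1) = \<beta> \<and>
       (\<forall>x\<in>{p$1-\<delta><..<p$1+\<delta>}. (u has_real_derivative v x) (at x) \<and>
          (v has_real_derivative - h x * u x) (at x))"
    using linear_ode2_local_existence[OF h, of "p $ 1"] by metis
  define I where "I = {p$1-\<delta><..<p$1+\<delta>}"
  obtain u1 v1 where u1: "u1 (p$1) = 1" "v1 (p$1) = 0"
    and d1: "\<And>x. x \<in> I \<Longrightarrow> (u1 has_real_derivative v1 x) (at x)"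
      "\<And>x. x \<in> I \<Longrightarrow> (v1 has_real_derivative - h x * u1 x) (at x)"
    using ex[of 1 0] unfolding I_def by blast
  obtain u2 v2 where u2: "u2 (p$1) = 0" "v2 (p$1) = 1"
    and d2: "\<And>x. x \<in> I \<Longrightarrow> (u2 has_real_derivative v2 x) (at x)"
      "\<And>x. x \<in> I \<Longrightarrow> (v2 has_real_derivative - h x * u2 x) (at x)"
    using ex[of 0 1] unfolding I_def by blast
  have pI: "p $ 1 \<in> I" using \<delta> by (simp add: I_def)
  have wronskian: "u1 x * v2 x - u2 x * v1 x = 1" if x: "x \<in> I" for x
  proof -
    have "((\<lambda>x. u1 x * v2 x - u2 x * v1 x) has_real_derivative 0) (at x within I)"
      if "x \<in> I" for x
      using DERIV_diff[OF DERIV_mult[OF d1(1)[OF that] d2(2)[OF that]]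
          DERIV_mult[OF d2(1)[OF that] d1(2)[OF that]]]
      by (auto simp: algebra_simps intro: has_field_derivative_at_within)
    then have "\<exists>k. \<forall>x\<in>I. u1 x * v2 x - u2 x * v1 x = k"
      by (intro has_field_derivative_zero_constant) (auto simp: I_def)
    then show ?thesis using x pI u1 u2 by fastforce
  qed
  define U0 where "U0 = {q \<in> H0 h. q $ 1 \<in> I}"
  have openU0: "open U0"
  proof -
    have "open ((\<lambda>q::real^2. q $ 1) -` I)"
      unfolding I_def by (auto intro!: open_vimage continuous_intros)
    moreover have "U0 = H0 h \<inter> (\<lambda>q. q $ 1) -` I" by (auto simp: U0_def)
    ultimately show ?thesis by (simp add: open_Int open_H0[OF h])
  qed
  \<comment> \<open>A moving frame: \<open>P\<close> and \<open>Q\<close> come from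
    \<open>u u\<^sup>T\<close> and \<open>u' u'\<^sup>T\<close> and are null vectors with product
    1/2; \<open>V\<close> is the derivative of \<open>P\<close>, orthogonal to both, with
    \<open>ads_form V V = -1\<close>.\<close>
  define P where "P x = sym_prod (u1 x) (u2 x) (u1 x) (u2 x)" for x
  define Q where "Q x = sym_prod (v1 x) (v2 x) (v1 x) (v2 x)" for x
  define V where "V x = 2 *\<^sub>R sym_prod (u1 x) (u2 x) (v1 x) (v2 x)" for x
  have PQV: "ads_form (P x) (P x) = 0" "ads_form (Q x) (Q x) = 0" "ads_form (P x) (Q x) = 1/2"
    "ads_form (Q x) (P x) = 1/2" "ads_form (V x) (V x) = - 1"
    "ads_form (V x) (P x) = 0" "ads_form (V x) (Q x) = 0"
    "ads_form (P x) (V x) = 0" "ads_form (Q x) (V x) = 0" if "x \<in> I" for x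
  proof -
    have "v1 x * u2 x - v2 x * u1 x = - 1"
      using wronskian[OF that] by (simp add: algebra_simps)
    with wronskian[OF that] show "ads_form (P x) (P x) = 0" "ads_form (Q x) (Q x) = 0"
      "ads_form (P x) (Q x) = 1/2" "ads_form (Q x) (P x) = 1/2" "ads_form (V x) (V x) = - 1"
      "ads_form (V x) (P x) = 0" "ads_form (V x) (Q x) = 0"
      "ads_form (P x) (V x) = 0" "ads_form (Q x) (V x) = 0"
      by (simp_all add: P_def Q_def V_def ads_form_bilinear ads_form_sym_prod)
  qed
  have derP: "(P has_vector_derivative V x) (at x)" if "x \<in> I" for x
    unfolding P_def [abs_def]
    by (rule has_vector_derivative_eq_rhs[OF has_vector_derivative_sym_prod[OF
          d1(1)[OF that] d2(1)[OF that] d1(1)[OF that] d2(1)[OF that]]])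
      (simp add: V_def sym_prod_def vec_eq_iff forall_3 vector_3 algebra_simps)
  have derQ: "(Q has_vector_derivative (- h x) *\<^sub>R V x) (at x)" if "x \<in> I" for x
    unfolding Q_def [abs_def]
    by (rule has_vector_derivative_eq_rhs[OF has_vector_derivative_sym_prod[OF
          d1(2)[OF that] d2(2)[OF that] d1(2)[OF that] d2(2)[OF that]]])
      (simp add: V_def sym_prod_def vec_eq_iff forall_3 vector_3 algebra_simps)
  have contV: "continuous_on I V"
    unfolding V_def
    by (intro continuous_intros continuous_on_sym_prod)
      (meson d1 d2 DERIV_isCont continuous_at_imp_continuous_on)+
  have contP: "continuous_on I P" and contQ: "continuous_on I Q"
    using derP derQ
    by (meson has_vector_derivative_continuous continuous_at_imp_continuous_on)+
  define \<phi> where "\<phi> q = (q $ 2) *\<^sub>R P (q $ 1) - (1 / q $ 2) *\<^sub>R Q (q $ 1)" for q :: "real^2"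
  \<comment> \<open>\<open>A\<close> and \<open>B\<close> are the partial derivatives of
    \<open>\<phi>\<close> in \<open>x\<close> and in \<open>\<Psi>\<close>. They are orthogonal, and
    their squares are the two diagonal entries of the metric.\<close>
  define A where "A q = (q $ 2 + h (q $ 1) / q $ 2) *\<^sub>R V (q $ 1)" for q :: "real^2"
  define B where "B q = P (q $ 1) + (1 / (q $ 2)\<^sup>2) *\<^sub>R Q (q $ 1)" for q :: "real^2"
  define D :: "real^2 \<Rightarrow> (real^2) \<Rightarrow>\<^sub>L (real^3)" where
    "D q = Blinfun (\<lambda>v. (v $ 1) *\<^sub>R A q + (v $ 2) *\<^sub>R B q)" for q
  have D: "blinfun_apply (D q) v = (v $ 1) *\<^sub>R A q + (v $ 2) *\<^sub>R B q" for q v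
    unfolding D_def
    by (subst bounded_linear_Blinfun_apply)
      (auto intro!: bounded_linear_add bounded_linear_scaleR_const bounded_linear_vec_nth)
  have U0D: "q $ 1 \<in> I" "q $ 2 > 0" "(q $ 2)\<^sup>2 \<noteq> - h (q $ 1)" "q \<in> H0 h" if "q \<in> U0" for q
    using that by (auto simp: U0_def H0_def)
  have AB: "ads_form (A q) (A q) = - ((h (q $ 1) + (q $ 2)\<^sup>2)\<^sup>2) / (q $ 2)\<^sup>2"
    "ads_form (A q) (B q) = 0" "ads_form (B q) (A q) = 0" "ads_form (B q) (B q) = 1 / (q $ 2)\<^sup>2"
    if "q \<in> U0" for q
    using U0D[OF that]
    by (simp_all add: A_def B_def ads_form_bilinear PQV) (simp add: field_simps power2_eq_square)
  have der: "(\<phi> has_derivative blinfun_apply (D q)) (at q)" if "q \<in> U0" for q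
  proof -
    have nth: "((\<lambda>q::real^2. q $ i) has_derivative (\<lambda>v. v $ i)) (at q)" for i
      by (rule bounded_linear_imp_has_derivative[OF bounded_linear_vec_nth])
    have comp: "((\<lambda>q::real^2. f (q $ 1)) has_derivative (\<lambda>v. (v $ 1) *\<^sub>R f')) (at q)"
      if "(f has_vector_derivative f') (at (q $ 1))" for f :: "real \<Rightarrow> real^3" and f'
      using has_derivative_compose[OF nth that[unfolded has_vector_derivative_def]] .
    note U = U0D[OF that]
    have "(\<phi> has_derivative (\<lambda>v. (q $ 2) *\<^sub>R ((v $ 1) *\<^sub>R V (q $ 1)) + (v $ 2) *\<^sub>R P (q $ 1)
        - ((1 / q $ 2) *\<^sub>R ((v $ 1) *\<^sub>R ((- h (q $ 1)) *\<^sub>R V (q $ 1)))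
           + (- (v $ 2) / (q $ 2)\<^sup>2) *\<^sub>R Q (q $ 1)))) (at q)"
      unfolding \<phi>_def [abs_def]
      by (intro has_derivative_diff has_derivative_scaleR nth comp derP derQ U(1))
        (use U(2) in \<open>auto intro!: derivative_eq_intros nth simp: field_simps power2_eq_square\<close>)
    then show ?thesis
      by (rule has_derivative_eq_rhs)
        (auto simp: D A_def B_def fun_eq_iff algebra_simps)
  qed
  have contA: "continuous_on U0 A" and contB: "continuous_on U0 B"
    unfolding A_def [abs_def] B_def [abs_def] using U0D
    by (intro continuous_intros continuous_on_compose2[OF contV] continuous_on_compose2[OF contP]
        continuous_on_compose2[OF contQ] continuous_on_compose2[OF h]; force)+
  have contD: "continuous_on U0 D"
    by (rule continuous_on_blinfun_componentwise) (auto simp: D intro!: continuous_intros contA contB)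
  have iso: "ads_form (blinfun_apply (D q) v) (blinfun_apply (D q) w) = v \<bullet> (metric_h h q *v w)"
    if "q \<in> U0" for q v w
    by (simp add: D metric_h_form ads_form_bilinear AB[OF that] algebra_simps)
  have quadric: "\<phi> q \<in> AdS2" if "q \<in> U0" for q
    using U0D[OF that] by (simp add: AdS2_def \<phi>_def ads_form_bilinear PQV)
  have pU0: "p \<in> U0" using p pI by (simp add: U0_def)
  \<comment> \<open>Coordinates with respect to the orthogonal pair \<open>A p\<close>,
    \<open>B p\<close>. This left inverse of the derivative exists because
    \<open>h + \<Psi>\<^sup>2 \<noteq> 0\<close> on \<open>H0 h\<close> makes
    \<open>ads_form (A p) (A p)\<close> nonzero.\<close>
  define L :: "real^3 \<Rightarrow> real^2" where "L w = vector [ads_form w (A p) / ads_form (A p) (A p),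
      ads_form w (B p) / ads_form (B p) (B p)]" for w
  have L: "L w = (ads_form w (A p) / ads_form (A p) (A p)) *\<^sub>R axis 1 1
      + (ads_form w (B p) / ads_form (B p) (B p)) *\<^sub>R axis 2 1" for w
    by (simp add: L_def vec_eq_iff forall_2 vector_2 axis_def)
  obtain r where r: "r > 0" "ball p r \<subseteq> U0" "inj_on \<phi> (ball p r)"
  proof (rule has_derivative_locally_injective[OF pU0 openU0, of L "\<lambda>q. blinfun_apply (D q)" \<phi>])
    show "bounded_linear L"
      unfolding L [abs_def]
      by (intro bounded_linear_add bounded_linear_scaleR_const
          bounded_linear_compose[OF bounded_linear_divide bounded_linear_ads_form_left])
    show "L \<circ> blinfun_apply (D p) = id"
      using U0D[OF pU0]
      by (auto simp: fun_eq_iff L_def D ads_form_bilinear AB[OF pU0] vec_eq_iff forall_2 vector_2)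
    show "(\<phi> has_derivative blinfun_apply (D x)) (at x)" if "x \<in> U0" for x
      by (rule der[OF that])
    show "\<exists>d>0. \<forall>x. dist p x < d \<longrightarrow> onorm (\<lambda>v. blinfun_apply (D x) v - blinfun_apply (D p) v) < e"
      if "e > 0" for e
    proof -
      have "isCont D p" using contD openU0 pU0 by (simp add: continuous_on_eq_continuous_at)
      then obtain d where "d > 0" "\<And>x. dist x p < d \<Longrightarrow> dist (D x) (D p) < e"
        using \<open>e > 0\<close> unfolding continuous_at_eps_delta by blast
      moreover have "dist (D x) (D p) = onorm (\<lambda>v. blinfun_apply (D x) v - blinfun_apply (D p) v)" for x
        by (simp add: dist_norm norm_blinfun.rep_eq blinfun.diff_left[abs_def])
      ultimately show ?thesis by (metis dist_commute)
    qed
  qed auto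
  have "continuous_on (ball p r) \<phi>"
    using der r(2) by (meson has_derivative_continuous continuous_at_imp_continuous_on subsetD)
  then have "openin (top_of_set AdS2) (\<phi> ` ball p r)"
    by (intro openin_AdS2_image) (use r quadric in auto)
  then show "\<exists>U \<phi>. \<exists>\<phi>' :: real ^ 2 \<Rightarrow> ((real ^ 2) \<Rightarrow>\<^sub>L (real ^ 3)).
        open U \<and> p \<in> U \<and> U \<subseteq> H0 h \<and>
        inj_on \<phi> U \<and> openin (top_of_set AdS2) (\<phi> ` U) \<and>
        continuous_on U \<phi>' \<and>
        (\<forall>q\<in>U. (\<phi> has_derivative blinfun_apply (\<phi>' q)) (at q) \<and>
           (\<forall>v w. ads_form (blinfun_apply (\<phi>' q) v) (blinfun_apply (\<phi>' q) w)
                    = v \<bullet> (metric_h h q *v w)))"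
    using r der iso continuous_on_subset[OF contD r(2)] U0D(4)
    by (intro exI[of _ "ball p r"] exI[of _ \<phi>] exI[of _ D]) auto
qed

theorem theorem2:
  fixes h :: "real \<Rightarrow> real"
  assumes "h C1_differentiable_on UNIV"
  shows
    "(\<forall>(x0::real) (a::ereal) (b::ereal) (\<Psi>::real \<Rightarrow> real).
        a < ereal x0 \<longrightarrow> ereal x0 < b \<longrightarrow> admissible h (einterval a b) \<Psi> \<longrightarrow>
          (general_solution h (einterval a b) (u_top h \<Psi> x0) (u_bot h \<Psi> x0)
             \<longleftrightarrow> explicit_geodesic_equation h (einterval a b) \<Psi>) \<and>
          (explicit_geodesic_equation h (einterval a b) \<Psi>
             \<longleftrightarrow> explicit_geodesic h x0 (einterval a b) \<Psi>)) \<and>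
     locally_AdS2 (H0 h) (metric_h h) \<and>
     (\<forall>x0::real. \<exists>(a::real) (b::real) (\<Psi>::real \<Rightarrow> real).
        a < x0 \<and> x0 < b \<and> admissible h {a<..<b} \<Psi> \<and>
        explicit_geodesic h x0 {a<..<b} \<Psi> \<and>
        general_solution h {a<..<b} (u_top h \<Psi> x0) (u_bot h \<Psi> x0))"
proof (intro conjI allI impI)
  fix x0 :: real and a b :: ereal and \<Psi> :: "real \<Rightarrow> real"
  assume "a < ereal x0" "ereal x0 < b" "admissible h (einterval a b) \<Psi>"
  then interpret admissible_curve h \<Psi> a b x0
    using assms by unfold_locales (simp_all add: einterval_iff)
  show "general_solution h (einterval a b) (u_top h \<Psi> x0) (u_bot h \<Psi> x0)
      \<longleftrightarrow> explicit_geodesic_equation h (einterval a b) \<Psi>"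
    using general_solution_imp_equation equation_imp_general_solution by blast
  show "explicit_geodesic_equation h (einterval a b) \<Psi>
      \<longleftrightarrow> explicit_geodesic h x0 (einterval a b) \<Psi>"
    using explicit_geodesic_imp_equation equation_imp_explicit_geodesic by blast
next
  have "continuous_on UNIV h"
    using assms by (rule C1_differentiable_imp_continuous_on)
  then show "locally_AdS2 (H0 h) (metric_h h)"
    by (rule locally_AdS2_metric_h)
next
  fix x0 :: real
  obtain a b :: real and \<Psi> where ab: "a < x0" "x0 < b" and adm: "admissible h {a<..<b} \<Psi>"
    and eq: "explicit_geodesic_equation h {a<..<b} \<Psi>"
    using explicit_geodesic_equation_local_existence[OF assms] by metis
  interpret admissible_curve h \<Psi> "ereal a" "ereal b" x0
    using assms ab adm by unfold_locales simp_all
  show "\<exists>(a::real) (b::real) (\<Psi>::real \<Rightarrow> real).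
        a < x0 \<and> x0 < b \<and> admissible h {a<..<b} \<Psi> \<and>
        explicit_geodesic h x0 {a<..<b} \<Psi> \<and>
        general_solution h {a<..<b} (u_top h \<Psi> x0) (u_bot h \<Psi> x0)"
    using ab adm eq equation_imp_explicit_geodesic equation_imp_general_solution
    by (intro exI[of _ a] exI[of _ b] exI[of _ \<Psi>]) simp
qed

end
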